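(* For every positive integer $m$, there exists an $m$-fold covering of the plane $\mathbb{R}^2$ with open unit disks that cannot be split into $2$ coverings.
   Context: An open unit disk is an open Euclidean disk of radius $1$. A family $\mathcal{C}$ of subsets of $\mathbb{R}^d$ is an $m$-fold covering of a set $P\subseteq\mathbb{R}^d$ if every point of $P$ belongs to at least $m$ members of $\mathcal{C}$; a $1$-fold covering is called a covering. An $m$-fold covering $\mathcal{C}$ of $P$ can be split into $2$ coverings if $\mathcal{C}$ can be partitioned into two subfamilies, each of which is a covering of $P$. *)

theory Defs
  imports "HOL-Analysis.Analysis"
begin

text \<open>
  Families of subsets are rendered as sets of sets, so members are counted without repetition.
  Since \<^const>\<open>card\<close> is 0 on infinite sets, a point lying in infinitely many members
  needs a separate disjunct.
\<close>

definition fold_covering :: "nat \<Rightarrow> (real ^ 'd) set set \<Rightarrow> (real ^ 'd) set \<Rightarrow> bool" where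
  "fold_covering m \<C> P \<longleftrightarrow>
     (\<forall>x\<in>P. infinite {C \<in> \<C>. x \<in> C} \<or> m \<le> card {C \<in> \<C>. x \<in> C})"

abbreviation covering :: "(real ^ 'd) set set \<Rightarrow> (real ^ 'd) set \<Rightarrow> bool" where
  "covering \<equiv> fold_covering 1"

definition splits_into_2_coverings :: "(real ^ 'd) set set \<Rightarrow> (real ^ 'd) set \<Rightarrow> bool" where
  "splits_into_2_coverings \<C> P \<longleftrightarrow>
     (\<exists>\<A> \<B>. \<A> \<union> \<B> = \<C> \<and> \<A> \<inter> \<B> = {} \<and> covering \<A> P \<and> covering \<B> P)"

definition open_unit_disk :: "(real ^ 2) set \<Rightarrow> bool" where
  "open_unit_disk D \<longleftrightarrow> (\<exists>c. D = ball c 1)"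

end

theory Submission
  imports Defs
begin

text \<open>
  The plane is covered by two kinds of disks. A finite set \<open>P\<close> of centres and a finite set \<open>S\<close> of special points
  are chosen such that every point of \<open>S\<close> has at least \<open>m\<close> centres of \<open>P\<close> within distance \<open>1\<close>, and such that for every partition of
  \<open>P\<close> into two classes some point of \<open>S\<close> sees only centres of one class. To the disks around \<open>P\<close> one adds
  all open unit disks that keep away from \<open>S\<close>. The points of \<open>S\<close> are covered by the disks around \<open>P\<close> alone, so
  the family cannot be split; what must be shown is that every other point that is not covered \<open>m\<close> times by the disks
  around \<open>P\<close> is in one of the added disks, and then in infinitely many.

  All of \<open>P\<close> is placed near the origin, and \<open>S\<close> consists of points near \<open>(-1, 0)\<close> (the set \<open>R\<close>, with colour red)
  and near \<open>(1, 0)\<close> (the set \<open>B\<close>). In the coordinates \<open>(\<epsilon>\<^sup>2 x, \<epsilon> y)\<close> the unit disks around \<open>R\<close> and \<open>B\<close> become, in the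
  limit \<open>\<epsilon> \<rightarrow> 0\<close>, the translates of the parabolic caps \<open>x < - y\<^sup>2 / 2\<close> and \<open>x > y\<^sup>2 / 2\<close>. This model has
  exact self-similarities (\<open>gap_zoom\<close>), while all conditions imposed are finitely many strict inequalities or can be
  reduced to such, so that they survive for small \<open>\<epsilon>\<close>.

  In the model the following recursion is realized (\<open>ex_unsplittable_exposed\<close>). Suppose that every colouring of \<open>P\<close> makes some
  left cap with at least \<open>k\<close> points entirely red or some right cap with at least \<open>l\<close> points entirely
  non-red. From a configuration for \<open>(k, l + 1)\<close> and one for \<open>(k + 1, l)\<close> one for \<open>(k + 1, l + 1)\<close> arises by
  placing tiny sheared copies at heights \<open>-1\<close> and \<open>1\<close> and adding the origin, which belongs to the
  left caps of the first and the right caps of the second copy (\<open>unsplittable_zoom\<close>).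

  The points of \<open>R\<close> lie on a steep chain that bends less than a unit circle. Hence a unit disk can touch the chain in two
  neighbouring points from the left or from the right, and the translates of these disks reach all points near
  the chain other than those of \<open>R\<close> (\<open>avoidable_if_exposed\<close>). A disk touching from the right is centred near the origin
  and could contain points of \<open>B\<close> on its far side; the invariant \<open>exposed\<close> excludes this and is carried through the recursion
  (\<open>exposed_zoom\<close>). A compactness argument transfers these facts to true unit disks (\<open>eventually_covered_near\<close>), and
  points far from \<open>S\<close> are easily covered (\<open>eventually_covered\<close>).
\<close>

section \<open>Parabolic caps and their self-similarity\<close>

text \<open>
  Membership in both kinds of parabolic caps is one relation: \<open>gap s p < 0\<close> says that \<open>p\<close> lies in the cap
  \<open>x < fst s - (y - snd s)\<^sup>2 / 2\<close>, and \<open>gap p t < 0\<close> that it lies in the opposite cap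
  \<open>x > fst t + (y - snd t)\<^sup>2 / 2\<close>. In both cases the argument on the left stands for the point of the plane
  that is further to the left.
\<close>
definition gap :: "real \<times> real \<Rightarrow> real \<times> real \<Rightarrow> real" where
  "gap u v = fst v - fst u + (snd v - snd u)\<^sup>2 / 2"

lemma gap_uminus: "gap (- u) (- v) = gap v u"
  by (simp add: gap_def power2_eq_square algebra_simps)

text \<open>
  A family of caps is shrunk parabolically by \<open>\<delta>\<close>, sheared to slope \<open>3/4\<close> and moved to height \<open>h\<close>. Shearing
  changes the apex of a cap, in opposite directions for the two kinds of caps, so the map depends on the
  level \<open>n\<close> of the point: \<open>-1\<close> for the apex of a left cap, \<open>0\<close> for a point of the plane, \<open>1\<close> for the apex
  of a right cap. Any slope strictly between \<open>1/2\<close> and \<open>1\<close> would do: it must exceed \<open>1/2\<close> for the caps of a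
  small copy at height \<open>-1\<close> or \<open>1\<close> to reach the origin, and be less than \<open>1\<close> for them to miss the copy
  at the other height.
\<close>
definition zoom :: "real \<Rightarrow> real \<Rightarrow> real \<Rightarrow> real \<times> real \<Rightarrow> real \<times> real" where
  "zoom \<delta> n h u = (\<delta>\<^sup>2 * fst u + 3/4 * \<delta> * snd u - 9/32 * n, h + \<delta> * snd u - 3/4 * n)"

lemma fst_zoom: "fst (zoom \<delta> n h u) = \<delta>\<^sup>2 * fst u + 3/4 * \<delta> * snd u - 9/32 * n"
  and snd_zoom: "snd (zoom \<delta> n h u) = h + \<delta> * snd u - 3/4 * n"
  by (simp_all add: zoom_def)

lemma uminus_zoom: "- zoom \<delta> n h u = zoom \<delta> (- n) (- h) (- u)"
  by (simp add: zoom_def)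

lemma gap_zoom:
  assumes "n' = n + 1"
  shows "gap (zoom \<delta> n h u) (zoom \<delta> n' h v) = \<delta>\<^sup>2 * gap u v"
  by (simp add: gap_def zoom_def assms field_simps power2_eq_square)

text \<open>
  As \<open>\<delta>\<close> tends to \<open>0\<close>, each copy collapses to one point per level, so the incidences between points of
  different copies depend on their heights only.
\<close>
lemma tendsto_gap_zoom:
  assumes "n' = n + 1"
  shows "((\<lambda>\<delta>. gap (zoom \<delta> n h u) (zoom \<delta> n' h' v)) \<longlongrightarrow> (h' - h) * (h' - h - 3/2) / 2) (at_right 0)"
  unfolding gap_def fst_zoom snd_zoom assms
  by (rule tendsto_eq_intros refl | (simp add: field_simps power2_eq_square; fail))+

lemma gap_zoom_pos:
  assumes "n' = n + 1" "0 < (h' - h) * (h' - h - 3/2)"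
  shows "\<forall>\<^sub>F \<delta> in at_right 0. 0 < gap (zoom \<delta> n h u) (zoom \<delta> n' h' v)"
  by (rule order_tendstoD(1)[OF tendsto_gap_zoom[OF assms(1)]]) (use assms(2) in simp)

lemma gap_zoom_neg:
  assumes "n' = n + 1" "(h' - h) * (h' - h - 3/2) < 0"
  shows "\<forall>\<^sub>F \<delta> in at_right 0. gap (zoom \<delta> n h u) (zoom \<delta> n' h' v) < 0"
  by (rule order_tendstoD(2)[OF tendsto_gap_zoom[OF assms(1)]]) (use assms(2) in simp)

definition slope :: "real \<times> real \<Rightarrow> real \<times> real \<Rightarrow> real" where
  "slope s t = (fst t - fst s) / (snd t - snd s)"

section \<open>Exposed sets of apexes\<close>

text \<open>
  The left caps with apexes \<open>s\<close> and \<open>t\<close> have boundary parabolas that meet in the one point \<open>cross s t\<close>;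
  equivalently, this is the apex of the right cap whose boundary passes through \<open>s\<close> and \<open>t\<close>.
\<close>
definition cross :: "real \<times> real \<Rightarrow> real \<times> real \<Rightarrow> real \<times> real" where
  "cross s t = (let c = (snd s + snd t) / 2 - slope s t in (fst s - (snd s - c)\<^sup>2 / 2, c))"

lemma slope_zoom:
  assumes "\<delta> \<noteq> 0" "snd s \<noteq> snd t"
  shows "slope (zoom \<delta> n h s) (zoom \<delta> n h t) = \<delta> * slope s t + 3/4"
  using assms by (simp add: slope_def zoom_def field_simps power2_eq_square)

lemma cross_zoom:
  assumes "\<delta> \<noteq> 0" "snd s \<noteq> snd t"
  shows "cross (zoom \<delta> (- 1) h s) (zoom \<delta> (- 1) h t) = zoom \<delta> 0 h (cross s t)"
  unfolding cross_def Let_def slope_zoom[OF assms]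
  by (simp add: zoom_def field_simps power2_eq_square)

text \<open>
  Second divided differences below \<open>1/2\<close> mean that \<open>R\<close> bends less than the boundary of a cap, so that a
  cap of either kind can touch \<open>R\<close> from its side in any two neighbouring points without containing a point of \<open>R\<close>.
\<close>
definition tame :: "(real \<times> real) set \<Rightarrow> bool" where
  "tame R \<longleftrightarrow> inj_on snd R \<and>
     (\<forall>r\<in>R. \<forall>s\<in>R. \<forall>t\<in>R. snd r < snd s \<longrightarrow> snd s < snd t \<longrightarrow>
        \<bar>slope s t - slope r s\<bar> < (snd t - snd r) / 2)"

definition adjacent :: "(real \<times> real) set \<Rightarrow> real \<times> real \<Rightarrow> real \<times> real \<Rightarrow> bool" where
  "adjacent R s t \<longleftrightarrow> s \<in> R \<and> t \<in> R \<and> snd s < snd t \<and> (\<forall>r\<in>R. \<not> (snd s < snd r \<and> snd r < snd t))"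

text \<open>
  A disk touching \<open>R\<close> from the right is so large that its far end reaches the region of \<open>B\<close>. The second
  condition, that \<open>cross s t\<close> lies in no right cap of \<open>B\<close>, says that this disk, if it touches \<open>R\<close> in the neighbours
  \<open>s\<close> and \<open>t\<close>, avoids \<open>B\<close>.
\<close>
definition exposed :: "(real \<times> real) set \<Rightarrow> (real \<times> real) set \<Rightarrow> bool" where
  "exposed R B \<longleftrightarrow> tame R \<and> (\<forall>s t. adjacent R s t \<longrightarrow> (\<forall>b\<in>B. 0 < gap (cross s t) b))"

lemma tendsto_slope_zoom:
  "((\<lambda>\<delta>. slope (zoom \<delta> (- 1) (- 1) s) (zoom \<delta> (- 1) 1 t)) \<longlongrightarrow> 0) (at_right 0)"
  unfolding slope_def fst_zoom snd_zoom
  by (rule tendsto_eq_intros refl | (simp; fail))+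

text \<open>
  Inside one copy slopes tend to \<open>3/4\<close>, whereas a chord joining the two copies becomes vertical, that is, its
  slope tends to \<open>0\<close>. The difference \<open>3/4\<close> is below half the distance \<open>2\<close> of the copies.
\<close>
lemma slope_zoom_bend_below:
  "\<forall>\<^sub>F \<delta> in at_right 0. \<bar>slope (zoom \<delta> (- 1) (- 1) s) (zoom \<delta> (- 1) 1 t) - (\<delta> * m + 3/4)\<bar>
     < (snd (zoom \<delta> (- 1) 1 t) - snd (zoom \<delta> (- 1) (- 1) r)) / 2"
proof -
  have "((\<lambda>\<delta>. (snd (zoom \<delta> (- 1) 1 t) - snd (zoom \<delta> (- 1) (- 1) r)) / 2
        - \<bar>slope (zoom \<delta> (- 1) (- 1) s) (zoom \<delta> (- 1) 1 t) - (\<delta> * m + 3/4)\<bar>) \<longlongrightarrow> 1 / 4) (at_right 0)"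
    unfolding snd_zoom
    by (rule tendsto_eq_intros tendsto_slope_zoom refl | (simp; fail))+
  from order_tendstoD(1)[OF this, of 0] show ?thesis by (simp add: algebra_simps)
qed

lemma slope_zoom_bend_above:
  "\<forall>\<^sub>F \<delta> in at_right 0. \<bar>(\<delta> * m + 3/4) - slope (zoom \<delta> (- 1) (- 1) s) (zoom \<delta> (- 1) 1 t)\<bar>
     < (snd (zoom \<delta> (- 1) 1 r) - snd (zoom \<delta> (- 1) (- 1) s)) / 2"
proof -
  have "((\<lambda>\<delta>. (snd (zoom \<delta> (- 1) 1 r) - snd (zoom \<delta> (- 1) (- 1) s)) / 2
        - \<bar>(\<delta> * m + 3/4) - slope (zoom \<delta> (- 1) (- 1) s) (zoom \<delta> (- 1) 1 t)\<bar>) \<longlongrightarrow> 1 / 4) (at_right 0)"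
    unfolding snd_zoom
    by (rule tendsto_eq_intros tendsto_slope_zoom refl | (simp; fail))+
  from order_tendstoD(1)[OF this, of 0] show ?thesis by (simp add: algebra_simps)
qed

text \<open>
  The left caps of the two copies meet near \<open>(-7/32, 3/4)\<close>, which is outside the right caps of both copies.
\<close>
lemma cross_zoom_clear:
  assumes "h = 1 \<or> h = - 1"
  shows "\<forall>\<^sub>F \<delta> in at_right 0. 0 < gap (cross (zoom \<delta> (- 1) (- 1) s) (zoom \<delta> (- 1) 1 t)) (zoom \<delta> 1 h b)"
proof -
  have "((\<lambda>\<delta>. gap (cross (zoom \<delta> (- 1) (- 1) s) (zoom \<delta> (- 1) 1 t)) (zoom \<delta> 1 h b))
      \<longlongrightarrow> (if h = 1 then 1 / 16 else 49 / 16)) (at_right 0)"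
    unfolding gap_def cross_def Let_def fst_conv snd_conv
    unfolding fst_zoom snd_zoom
    by (rule tendsto_eq_intros tendsto_slope_zoom refl | (use assms in \<open>force simp: power2_eq_square\<close>))+
  from order_tendstoD(1)[OF this, of 0] show ?thesis by simp
qed

text \<open>
  A triple of points, or a pair of neighbours, that stays in one copy inherits its property from that copy because
  the maps \<open>zoom\<close> preserve bends and caps; all others are decided by the limits above. A neighbour pair of the
  union with both points in one copy is a neighbour pair of that copy, and the only other one consists of the
  top point of the lower copy and the bottom point of the upper one.
\<close>
lemma exposed_zoom:
  assumes fin: "finite R\<^sub>1" "finite R\<^sub>2" "finite B\<^sub>1" "finite B\<^sub>2"
    and ex: "exposed R\<^sub>1 B\<^sub>1" "exposed R\<^sub>2 B\<^sub>2"
  shows "\<forall>\<^sub>F \<delta> in at_right 0.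
    exposed (zoom \<delta> (- 1) (- 1) ` R\<^sub>1 \<union> zoom \<delta> (- 1) 1 ` R\<^sub>2) (zoom \<delta> 1 (- 1) ` B\<^sub>1 \<union> zoom \<delta> 1 1 ` B\<^sub>2)"
proof -
  have "\<forall>\<^sub>F \<delta> in at_right 0. (0::real) < \<delta>"
    by (simp add: eventually_at_right_less)
  moreover have "\<forall>\<^sub>F \<delta> in at_right 0. \<forall>r\<in>R\<^sub>1. \<forall>s\<in>R\<^sub>2. snd (zoom \<delta> (- 1) (- 1) r) < snd (zoom \<delta> (- 1) 1 s)"
  proof (intro eventually_ball_finite fin ballI)
    fix r s
    have "((\<lambda>\<delta>. snd (zoom \<delta> (- 1) 1 s) - snd (zoom \<delta> (- 1) (- 1) r)) \<longlongrightarrow> 2) (at_right 0)"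
      unfolding snd_zoom by (rule tendsto_eq_intros refl | (simp; fail))+
    from order_tendstoD(1)[OF this, of 0]
    show "\<forall>\<^sub>F \<delta> in at_right 0. snd (zoom \<delta> (- 1) (- 1) r) < snd (zoom \<delta> (- 1) 1 s)" by simp
  qed
  moreover have "\<forall>\<^sub>F \<delta> in at_right 0. \<forall>r\<in>R\<^sub>1. \<forall>s\<in>R\<^sub>1. \<forall>t\<in>R\<^sub>2.
      \<bar>slope (zoom \<delta> (- 1) (- 1) s) (zoom \<delta> (- 1) 1 t) - (\<delta> * slope r s + 3/4)\<bar>
     < (snd (zoom \<delta> (- 1) 1 t) - snd (zoom \<delta> (- 1) (- 1) r)) / 2"
    by (intro eventually_ball_finite fin ballI slope_zoom_bend_below)
  moreover have "\<forall>\<^sub>F \<delta> in at_right 0. \<forall>r\<in>R\<^sub>1. \<forall>s\<in>R\<^sub>2. \<forall>t\<in>R\<^sub>2.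
      \<bar>(\<delta> * slope s t + 3/4) - slope (zoom \<delta> (- 1) (- 1) r) (zoom \<delta> (- 1) 1 s)\<bar>
     < (snd (zoom \<delta> (- 1) 1 t) - snd (zoom \<delta> (- 1) (- 1) r)) / 2"
    by (intro eventually_ball_finite fin ballI slope_zoom_bend_above)
  moreover have "\<forall>\<^sub>F \<delta> in at_right 0. \<forall>s\<in>R\<^sub>1. \<forall>t\<in>R\<^sub>1. \<forall>b\<in>B\<^sub>2.
      0 < gap (zoom \<delta> 0 (- 1) (cross s t)) (zoom \<delta> 1 1 b)"
    by (intro eventually_ball_finite fin ballI gap_zoom_pos) auto
  moreover have "\<forall>\<^sub>F \<delta> in at_right 0. \<forall>s\<in>R\<^sub>2. \<forall>t\<in>R\<^sub>2. \<forall>b\<in>B\<^sub>1.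
      0 < gap (zoom \<delta> 0 1 (cross s t)) (zoom \<delta> 1 (- 1) b)"
    by (intro eventually_ball_finite fin ballI gap_zoom_pos) auto
  moreover have "\<forall>\<^sub>F \<delta> in at_right 0. \<forall>s\<in>R\<^sub>1. \<forall>t\<in>R\<^sub>2. \<forall>b\<in>B\<^sub>1.
      0 < gap (cross (zoom \<delta> (- 1) (- 1) s) (zoom \<delta> (- 1) 1 t)) (zoom \<delta> 1 (- 1) b)"
    by (intro eventually_ball_finite fin ballI cross_zoom_clear) auto
  moreover have "\<forall>\<^sub>F \<delta> in at_right 0. \<forall>s\<in>R\<^sub>1. \<forall>t\<in>R\<^sub>2. \<forall>b\<in>B\<^sub>2.
      0 < gap (cross (zoom \<delta> (- 1) (- 1) s) (zoom \<delta> (- 1) 1 t)) (zoom \<delta> 1 1 b)"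
    by (intro eventually_ball_finite fin ballI cross_zoom_clear) auto
  ultimately show ?thesis
  proof eventually_elim
    case (elim \<delta>)
    note pos = elim(1) and below = elim(2) and bend1 = elim(3) and bend2 = elim(4)
      and far1 = elim(5) and far2 = elim(6) and mid1 = elim(7) and mid2 = elim(8)
    define f where "f = zoom \<delta> (- 1) (- 1)"
    define g where "g = zoom \<delta> (- 1) 1"
    have ordf: "snd (f u) < snd (f v) \<longleftrightarrow> snd u < snd v"
      and ordg: "snd (g u) < snd (g v) \<longleftrightarrow> snd u < snd v" for u v
      using pos by (auto simp: f_def g_def zoom_def)
    have sepd: "snd (f r) < snd (g s)" "\<not> snd (g s) < snd (f r)" if "r \<in> R\<^sub>1" "s \<in> R\<^sub>2" for r s
      using below that by (force simp: f_def g_def)+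
    have slf: "slope (f u) (f v) = \<delta> * slope u v + 3/4"
      and slg: "slope (g u) (g v) = \<delta> * slope u v + 3/4" if "snd u < snd v" for u v
      using pos that by (auto simp: f_def g_def slope_zoom)
    have inj: "inj_on snd R\<^sub>1" "inj_on snd R\<^sub>2" using ex by (auto simp: exposed_def tame_def)
    have "inj_on snd (f ` R\<^sub>1 \<union> g ` R\<^sub>2)"
    proof (rule inj_onI)
      fix u v assume "u \<in> f ` R\<^sub>1 \<union> g ` R\<^sub>2" "v \<in> f ` R\<^sub>1 \<union> g ` R\<^sub>2" "snd u = snd v"
      moreover have "snd (f r) \<noteq> snd (g s)" "snd (g s) \<noteq> snd (f r)" if "r \<in> R\<^sub>1" "s \<in> R\<^sub>2" for r s
        using sepd[OF that] by auto
      moreover have "snd (f r) = snd (f s) \<longleftrightarrow> snd r = snd s" "snd (g r) = snd (g s) \<longleftrightarrow> snd r = snd s" for r s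
        using pos by (simp_all add: f_def g_def zoom_def)
      ultimately show "u = v"
        by (elim UnE imageE) (simp_all add: inj_on_eq_iff[OF inj(1)] inj_on_eq_iff[OF inj(2)])
    qed
    moreover have "\<bar>slope s t - slope r s\<bar> < (snd t - snd r) / 2"
      if mem: "r \<in> f ` R\<^sub>1 \<union> g ` R\<^sub>2" "s \<in> f ` R\<^sub>1 \<union> g ` R\<^sub>2" "t \<in> f ` R\<^sub>1 \<union> g ` R\<^sub>2"
        and lt: "snd r < snd s" "snd s < snd t" for r s t
    proof -
      have same: "\<bar>(\<delta> * slope s t + 3/4) - (\<delta> * slope r s + 3/4)\<bar> < \<delta> * (snd t - snd r) / 2"
        if "r \<in> X" "s \<in> X" "t \<in> X" "tame X" "snd r < snd s" "snd s < snd t" for X and r s t :: "real \<times> real"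
      proof -
        have "\<bar>slope s t - slope r s\<bar> < (snd t - snd r) / 2"
          using that by (auto simp: tame_def)
        then have "\<delta> * \<bar>slope s t - slope r s\<bar> < \<delta> * ((snd t - snd r) / 2)"
          using pos by simp
        moreover have "\<delta> * \<bar>slope s t - slope r s\<bar> = \<bar>(\<delta> * slope s t + 3/4) - (\<delta> * slope r s + 3/4)\<bar>"
          using pos by (simp add: abs_mult flip: right_diff_distrib)
        ultimately show ?thesis by simp
      qed
      have width: "snd (f u) - snd (f v) = \<delta> * (snd u - snd v)" "snd (g u) - snd (g v) = \<delta> * (snd u - snd v)" for u v
        by (simp_all add: f_def g_def zoom_def algebra_simps)
      have tm: "tame R\<^sub>1" "tame R\<^sub>2" using ex by (auto simp: exposed_def)
      consider (111) r' s' t' where "r' \<in> R\<^sub>1" "s' \<in> R\<^sub>1" "t' \<in> R\<^sub>1" "r = f r'" "s = f s'" "t = f t'"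
        | (112) r' s' t' where "r' \<in> R\<^sub>1" "s' \<in> R\<^sub>1" "t' \<in> R\<^sub>2" "r = f r'" "s = f s'" "t = g t'"
        | (122) r' s' t' where "r' \<in> R\<^sub>1" "s' \<in> R\<^sub>2" "t' \<in> R\<^sub>2" "r = f r'" "s = g s'" "t = g t'"
        | (222) r' s' t' where "r' \<in> R\<^sub>2" "s' \<in> R\<^sub>2" "t' \<in> R\<^sub>2" "r = g r'" "s = g s'" "t = g t'"
        using mem lt sepd(2) by (elim UnE imageE) metis+
      then show ?thesis
      proof cases
        case 111
        then show ?thesis using lt same[OF _ _ _ tm(1)] by (simp add: ordf slf width)
      next
        case 112
        then show ?thesis using lt bend1 by (simp add: ordf slf f_def[symmetric] g_def[symmetric])
      next
        case 122
        then show ?thesis using lt bend2 by (simp add: ordg slg f_def[symmetric] g_def[symmetric])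
      next
        case 222
        then show ?thesis using lt same[OF _ _ _ tm(2)] by (simp add: ordg slg width)
      qed
    qed
    moreover have "0 < gap (cross s t) b"
      if adj: "adjacent (f ` R\<^sub>1 \<union> g ` R\<^sub>2) s t" and b: "b \<in> zoom \<delta> 1 (- 1) ` B\<^sub>1 \<union> zoom \<delta> 1 1 ` B\<^sub>2" for s t b
    proof -
      have mem: "s \<in> f ` R\<^sub>1 \<union> g ` R\<^sub>2" "t \<in> f ` R\<^sub>1 \<union> g ` R\<^sub>2" and lt: "snd s < snd t"
        and none: "\<And>r. r \<in> R\<^sub>1 \<Longrightarrow> \<not> (snd s < snd (f r) \<and> snd (f r) < snd t)"
                  "\<And>r. r \<in> R\<^sub>2 \<Longrightarrow> \<not> (snd s < snd (g r) \<and> snd (g r) < snd t)"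
        using adj by (auto simp: adjacent_def)
      consider (11) s' t' where "s' \<in> R\<^sub>1" "t' \<in> R\<^sub>1" "s = f s'" "t = f t'"
        | (12) s' t' where "s' \<in> R\<^sub>1" "t' \<in> R\<^sub>2" "s = f s'" "t = g t'"
        | (22) s' t' where "s' \<in> R\<^sub>2" "t' \<in> R\<^sub>2" "s = g s'" "t = g t'"
        using mem lt sepd(2) by blast
      then show ?thesis
      proof cases
        case 11
        have st: "snd s' < snd t'" using lt 11 ordf by simp
        have adj': "adjacent R\<^sub>1 s' t'"
          using 11 none(1) st by (auto simp: adjacent_def ordf)
        have "cross s t = zoom \<delta> 0 (- 1) (cross s' t')"
          using st pos by (simp add: 11 f_def cross_zoom)
        moreover have "0 < gap (cross s' t') c" if "c \<in> B\<^sub>1" for c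
          using ex(1) adj' that unfolding exposed_def by blast
        ultimately show ?thesis using b far1 11(1,2) pos by (auto simp: gap_zoom)
      next
        case 12
        then show ?thesis using b mid1 mid2 by (auto simp: f_def g_def)
      next
        case 22
        have st: "snd s' < snd t'" using lt 22 ordg by simp
        have adj': "adjacent R\<^sub>2 s' t'"
          using 22 none(2) st by (auto simp: adjacent_def ordg)
        have "cross s t = zoom \<delta> 0 1 (cross s' t')"
          using st pos by (simp add: 22 g_def cross_zoom)
        moreover have "0 < gap (cross s' t') c" if "c \<in> B\<^sub>2" for c
          using ex(2) adj' that unfolding exposed_def by blast
        ultimately show ?thesis using b far2 22(1,2) pos by (auto simp: gap_zoom)
      qed
    qed
    ultimately show ?case
      unfolding exposed_def tame_def f_def[symmetric] g_def[symmetric]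
      by (intro conjI ballI allI impI) (simp_all only:)
  qed
qed

section \<open>Finite families of caps that cannot be two-coloured\<close>

text \<open>
  The two kinds of caps compete for different colours, which is what makes the recursion on \<open>k\<close> and \<open>l\<close> work.
  Points on the boundary of a cap are excluded so that small perturbations of the caps do not change what they contain.
\<close>
definition unsplittable :: "nat \<Rightarrow> nat \<Rightarrow> (real \<times> real) set \<Rightarrow> (real \<times> real) set \<Rightarrow> (real \<times> real) set \<Rightarrow> bool" where
  "unsplittable k l P R B \<longleftrightarrow> finite P \<and> finite R \<and> finite B \<and>
     (\<forall>p\<in>P. (\<forall>s\<in>R. gap s p \<noteq> 0) \<and> (\<forall>t\<in>B. gap p t \<noteq> 0)) \<and>
     (\<forall>s\<in>R. k \<le> card {p\<in>P. gap s p < 0}) \<and>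
     (\<forall>t\<in>B. l \<le> card {p\<in>P. gap p t < 0}) \<and>
     (\<forall>red. (\<exists>s\<in>R. \<forall>p\<in>P. gap s p < 0 \<longrightarrow> red p) \<or> (\<exists>t\<in>B. \<forall>p\<in>P. gap p t < 0 \<longrightarrow> \<not> red p))"

lemma unsplittable_colouring:
  assumes "unsplittable k l P R B"
  shows "(\<exists>s\<in>R. \<forall>p\<in>P. gap s p < 0 \<longrightarrow> red p) \<or> (\<exists>t\<in>B. \<forall>p\<in>P. gap p t < 0 \<longrightarrow> \<not> red p)"
  using assms by (simp only: unsplittable_def)

text \<open>
  The origin is added to all left caps of the lower copy and to all right caps of the upper copy; apart from
  that, caps contain points of their own copy only. If the origin is red, a red left cap of the lower
  copy stays red and a non-red right cap of the lower copy is unchanged; if it is not red, the same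
  holds for the upper copy with the two kinds of caps exchanged.
\<close>
lemma unsplittable_zoom:
  assumes un1: "unsplittable k (Suc l) P\<^sub>1 R\<^sub>1 B\<^sub>1" and un2: "unsplittable (Suc k) l P\<^sub>2 R\<^sub>2 B\<^sub>2"
  shows "\<forall>\<^sub>F \<delta> in at_right 0. unsplittable (Suc k) (Suc l)
    (insert 0 (zoom \<delta> 0 (- 1) ` P\<^sub>1 \<union> zoom \<delta> 0 1 ` P\<^sub>2))
    (zoom \<delta> (- 1) (- 1) ` R\<^sub>1 \<union> zoom \<delta> (- 1) 1 ` R\<^sub>2) (zoom \<delta> 1 (- 1) ` B\<^sub>1 \<union> zoom \<delta> 1 1 ` B\<^sub>2)"
proof -
  have fin: "finite P\<^sub>1" "finite P\<^sub>2" "finite R\<^sub>1" "finite R\<^sub>2" "finite B\<^sub>1" "finite B\<^sub>2"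
    using un1 un2 by (auto simp: unsplittable_def)
  have zero: "zoom \<delta> 0 0 0 = 0" for \<delta> by (simp add: zoom_def zero_prod_def)
  have "\<forall>\<^sub>F \<delta> in at_right 0. (0::real) < \<delta>"
    by (simp add: eventually_at_right_less)
  moreover have "\<forall>\<^sub>F \<delta> in at_right 0. (\<forall>x\<in>P\<^sub>1. snd (zoom \<delta> 0 (- 1) x) < 0) \<and> (\<forall>y\<in>P\<^sub>2. 0 < snd (zoom \<delta> 0 1 y))"
  proof (intro eventually_ball_finite fin ballI eventually_conj)
    fix x y :: "real \<times> real"
    have "((\<lambda>\<delta>. snd (zoom \<delta> 0 h x)) \<longlongrightarrow> h) (at_right 0)" for h x
      unfolding snd_zoom by (rule tendsto_eq_intros refl | (simp; fail))+
    from order_tendstoD(2)[OF this, of "- 1" 0 x] order_tendstoD(1)[OF this, of 0 1 y]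
    show "\<forall>\<^sub>F \<delta> in at_right 0. snd (zoom \<delta> 0 (- 1) x) < 0" "\<forall>\<^sub>F \<delta> in at_right 0. 0 < snd (zoom \<delta> 0 1 y)"
      by simp_all
  qed
  moreover have "\<forall>\<^sub>F \<delta> in at_right 0. (\<forall>s\<in>R\<^sub>1. gap (zoom \<delta> (- 1) (- 1) s) (zoom \<delta> 0 0 0) < 0) \<and>
      (\<forall>s\<in>R\<^sub>1. \<forall>p\<in>P\<^sub>2. 0 < gap (zoom \<delta> (- 1) (- 1) s) (zoom \<delta> 0 1 p))"
    by (intro eventually_conj eventually_ball_finite fin ballI gap_zoom_pos gap_zoom_neg) auto
  moreover have "\<forall>\<^sub>F \<delta> in at_right 0. (\<forall>s\<in>R\<^sub>2. 0 < gap (zoom \<delta> (- 1) 1 s) (zoom \<delta> 0 0 0)) \<and>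
      (\<forall>s\<in>R\<^sub>2. \<forall>p\<in>P\<^sub>1. 0 < gap (zoom \<delta> (- 1) 1 s) (zoom \<delta> 0 (- 1) p))"
    by (intro eventually_conj eventually_ball_finite fin ballI gap_zoom_pos gap_zoom_neg) auto
  moreover have "\<forall>\<^sub>F \<delta> in at_right 0. (\<forall>t\<in>B\<^sub>1. 0 < gap (zoom \<delta> 0 0 0) (zoom \<delta> 1 (- 1) t)) \<and>
      (\<forall>t\<in>B\<^sub>1. \<forall>p\<in>P\<^sub>2. 0 < gap (zoom \<delta> 0 1 p) (zoom \<delta> 1 (- 1) t))"
    by (intro eventually_conj eventually_ball_finite fin ballI gap_zoom_pos gap_zoom_neg) auto
  moreover have "\<forall>\<^sub>F \<delta> in at_right 0. (\<forall>t\<in>B\<^sub>2. gap (zoom \<delta> 0 0 0) (zoom \<delta> 1 1 t) < 0) \<and>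
      (\<forall>t\<in>B\<^sub>2. \<forall>p\<in>P\<^sub>1. 0 < gap (zoom \<delta> 0 (- 1) p) (zoom \<delta> 1 1 t))"
    by (intro eventually_conj eventually_ball_finite fin ballI gap_zoom_pos gap_zoom_neg) auto
  ultimately show ?thesis
  proof eventually_elim
    case (elim \<delta>)
    note pos = elim(1) and sepd = elim(2) and R1 = elim(3)[unfolded zero] and R2 = elim(4)[unfolded zero]
      and B1 = elim(5)[unfolded zero] and B2 = elim(6)[unfolded zero]
    define f where "f = zoom \<delta> 0 (- 1)"
    define g where "g = zoom \<delta> 0 1"
    define P where "P = insert 0 (f ` P\<^sub>1 \<union> g ` P\<^sub>2)"
    have inj: "inj_on f X" "inj_on g X" for X
      using pos by (auto simp: inj_on_def f_def g_def zoom_def prod_eq_iff)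
    have out: "0 \<notin> f ` {x\<in>P\<^sub>1. Q x}" "0 \<notin> g ` {x\<in>P\<^sub>2. Q x}" for Q
      using sepd by (force simp: f_def g_def)+
    have scale: "\<delta>\<^sup>2 * x < 0 \<longleftrightarrow> x < 0" for x
      using pos by (simp add: mult_less_0_iff)
    have scaled [simp]:
      "gap (zoom \<delta> (- 1) (- 1) s) (f p) < 0 \<longleftrightarrow> gap s p < 0" "gap (zoom \<delta> (- 1) 1 s) (g p) < 0 \<longleftrightarrow> gap s p < 0"
      "gap (f p) (zoom \<delta> 1 (- 1) s) < 0 \<longleftrightarrow> gap p s < 0" "gap (g p) (zoom \<delta> 1 1 s) < 0 \<longleftrightarrow> gap p s < 0"
      "gap (zoom \<delta> (- 1) (- 1) s) (f p) = 0 \<longleftrightarrow> gap s p = 0" "gap (zoom \<delta> (- 1) 1 s) (g p) = 0 \<longleftrightarrow> gap s p = 0"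
      "gap (f p) (zoom \<delta> 1 (- 1) s) = 0 \<longleftrightarrow> gap p s = 0" "gap (g p) (zoom \<delta> 1 1 s) = 0 \<longleftrightarrow> gap p s = 0"
      for s p
      using pos by (simp_all add: f_def g_def gap_zoom scale)
    have fin': "finite {x\<in>P\<^sub>1. Q x}" "finite {x\<in>P\<^sub>2. Q x}" for Q using fin by auto
    have setR1: "{p\<in>P. gap (zoom \<delta> (- 1) (- 1) s) p < 0} = insert 0 (f ` {p\<in>P\<^sub>1. gap s p < 0})" if "s \<in> R\<^sub>1" for s
      using R1 that by (force simp: P_def g_def[symmetric])
    have setR2: "{p\<in>P. gap (zoom \<delta> (- 1) 1 s) p < 0} = g ` {p\<in>P\<^sub>2. gap s p < 0}" if "s \<in> R\<^sub>2" for s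
      using R2 that by (force simp: P_def f_def[symmetric])
    have setB1: "{p\<in>P. gap p (zoom \<delta> 1 (- 1) t) < 0} = f ` {p\<in>P\<^sub>1. gap p t < 0}" if "t \<in> B\<^sub>1" for t
      using B1 that by (force simp: P_def g_def[symmetric])
    have setB2: "{p\<in>P. gap p (zoom \<delta> 1 1 t) < 0} = insert 0 (g ` {p\<in>P\<^sub>2. gap p t < 0})" if "t \<in> B\<^sub>2" for t
      using B2 that by (force simp: P_def f_def[symmetric])
    have "k \<le> card {p\<in>P\<^sub>1. gap s p < 0}" if "s \<in> R\<^sub>1" for s
      using un1 that by (auto simp: unsplittable_def)
    moreover have "Suc k \<le> card {p\<in>P\<^sub>2. gap s p < 0}" if "s \<in> R\<^sub>2" for s
      using un2 that by (auto simp: unsplittable_def)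
    ultimately have cardR: "\<forall>s\<in>zoom \<delta> (- 1) (- 1) ` R\<^sub>1 \<union> zoom \<delta> (- 1) 1 ` R\<^sub>2. Suc k \<le> card {p\<in>P. gap s p < 0}"
      using out fin' by (auto simp: setR1 setR2 card_image[OF inj(1)] card_image[OF inj(2)])
    have "Suc l \<le> card {p\<in>P\<^sub>1. gap p t < 0}" if "t \<in> B\<^sub>1" for t
      using un1 that by (auto simp: unsplittable_def)
    moreover have "l \<le> card {p\<in>P\<^sub>2. gap p t < 0}" if "t \<in> B\<^sub>2" for t
      using un2 that by (auto simp: unsplittable_def)
    ultimately have cardB: "\<forall>t\<in>zoom \<delta> 1 (- 1) ` B\<^sub>1 \<union> zoom \<delta> 1 1 ` B\<^sub>2. Suc l \<le> card {p\<in>P. gap p t < 0}"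
      using out fin' by (auto simp: setB1 setB2 card_image[OF inj(1)] card_image[OF inj(2)])
    define R B where "R = zoom \<delta> (- 1) (- 1) ` R\<^sub>1 \<union> zoom \<delta> (- 1) 1 ` R\<^sub>2"
      and "B = zoom \<delta> 1 (- 1) ` B\<^sub>1 \<union> zoom \<delta> 1 1 ` B\<^sub>2"
    have colour: "(\<exists>s\<in>R. \<forall>p\<in>P. gap s p < 0 \<longrightarrow> red p) \<or> (\<exists>t\<in>B. \<forall>p\<in>P. gap p t < 0 \<longrightarrow> \<not> red p)" for red
    proof (cases "red 0")
      case True
      have "(\<exists>s\<in>R\<^sub>1. \<forall>p\<in>P\<^sub>1. gap s p < 0 \<longrightarrow> red (f p)) \<or> (\<exists>t\<in>B\<^sub>1. \<forall>p\<in>P\<^sub>1. gap p t < 0 \<longrightarrow> \<not> red (f p))"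
        by (rule unsplittable_colouring[OF un1])
      then show ?thesis
      proof (elim disjE bexE)
        fix s assume s: "s \<in> R\<^sub>1" "\<forall>p\<in>P\<^sub>1. gap s p < 0 \<longrightarrow> red (f p)"
        then have "\<forall>p\<in>{p\<in>P. gap (zoom \<delta> (- 1) (- 1) s) p < 0}. red p"
          unfolding setR1[OF s(1)] using True by auto
        then have "\<forall>p\<in>P. gap (zoom \<delta> (- 1) (- 1) s) p < 0 \<longrightarrow> red p"
          by blast
        moreover have "zoom \<delta> (- 1) (- 1) s \<in> R"
          using s(1) by (auto simp: R_def)
        ultimately show ?thesis by blast
      next
        fix t assume t: "t \<in> B\<^sub>1" "\<forall>p\<in>P\<^sub>1. gap p t < 0 \<longrightarrow> \<not> red (f p)"
        then have "\<forall>p\<in>{p\<in>P. gap p (zoom \<delta> 1 (- 1) t) < 0}. \<not> red p"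
          unfolding setB1[OF t(1)] by auto
        then have "\<forall>p\<in>P. gap p (zoom \<delta> 1 (- 1) t) < 0 \<longrightarrow> \<not> red p"
          by blast
        moreover have "zoom \<delta> 1 (- 1) t \<in> B"
          using t(1) by (auto simp: B_def)
        ultimately show ?thesis by blast
      qed
    next
      case False
      have "(\<exists>s\<in>R\<^sub>2. \<forall>p\<in>P\<^sub>2. gap s p < 0 \<longrightarrow> red (g p)) \<or> (\<exists>t\<in>B\<^sub>2. \<forall>p\<in>P\<^sub>2. gap p t < 0 \<longrightarrow> \<not> red (g p))"
        by (rule unsplittable_colouring[OF un2])
      then show ?thesis
      proof (elim disjE bexE)
        fix s assume s: "s \<in> R\<^sub>2" "\<forall>p\<in>P\<^sub>2. gap s p < 0 \<longrightarrow> red (g p)"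
        then have "\<forall>p\<in>{p\<in>P. gap (zoom \<delta> (- 1) 1 s) p < 0}. red p"
          unfolding setR2[OF s(1)] by auto
        then have "\<forall>p\<in>P. gap (zoom \<delta> (- 1) 1 s) p < 0 \<longrightarrow> red p"
          by blast
        moreover have "zoom \<delta> (- 1) 1 s \<in> R"
          using s(1) by (auto simp: R_def)
        ultimately show ?thesis by blast
      next
        fix t assume t: "t \<in> B\<^sub>2" "\<forall>p\<in>P\<^sub>2. gap p t < 0 \<longrightarrow> \<not> red (g p)"
        then have "\<forall>p\<in>{p\<in>P. gap p (zoom \<delta> 1 1 t) < 0}. \<not> red p"
          unfolding setB2[OF t(1)] using False by auto
        then have "\<forall>p\<in>P. gap p (zoom \<delta> 1 1 t) < 0 \<longrightarrow> \<not> red p"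
          by blast
        moreover have "zoom \<delta> 1 1 t \<in> B"
          using t(1) by (auto simp: B_def)
        ultimately show ?thesis by blast
      qed
    qed
    have gen: "s \<in> R\<^sub>1 \<Longrightarrow> p \<in> P\<^sub>1 \<Longrightarrow> gap s p \<noteq> 0" "t \<in> B\<^sub>1 \<Longrightarrow> p \<in> P\<^sub>1 \<Longrightarrow> gap p t \<noteq> 0"
        "s \<in> R\<^sub>2 \<Longrightarrow> p \<in> P\<^sub>2 \<Longrightarrow> gap s p \<noteq> 0" "t \<in> B\<^sub>2 \<Longrightarrow> p \<in> P\<^sub>2 \<Longrightarrow> gap p t \<noteq> 0" for s t p
      using un1 un2 by (simp_all add: unsplittable_def)
    have neR: "gap (zoom \<delta> (- 1) (- 1) s) (g p) \<noteq> 0" if "s \<in> R\<^sub>1" "p \<in> P\<^sub>2" for s p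
      using bspec[OF bspec[OF conjunct2[OF R1] that(1)] that(2)] by (simp add: g_def)
    have neR': "gap (zoom \<delta> (- 1) 1 s) (f p) \<noteq> 0" if "s \<in> R\<^sub>2" "p \<in> P\<^sub>1" for s p
      using bspec[OF bspec[OF conjunct2[OF R2] that(1)] that(2)] by (simp add: f_def)
    have neB: "gap (g p) (zoom \<delta> 1 (- 1) t) \<noteq> 0" if "t \<in> B\<^sub>1" "p \<in> P\<^sub>2" for t p
      using bspec[OF bspec[OF conjunct2[OF B1] that(1)] that(2)] by (simp add: g_def)
    have neB': "gap (f p) (zoom \<delta> 1 1 t) \<noteq> 0" if "t \<in> B\<^sub>2" "p \<in> P\<^sub>1" for t p
      using bspec[OF bspec[OF conjunct2[OF B2] that(1)] that(2)] by (simp add: f_def)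
    have ne0: "\<forall>s\<in>R\<^sub>1. gap (zoom \<delta> (- 1) (- 1) s) 0 \<noteq> 0" "\<forall>s\<in>R\<^sub>2. gap (zoom \<delta> (- 1) 1 s) 0 \<noteq> 0"
      "\<forall>t\<in>B\<^sub>1. gap 0 (zoom \<delta> 1 (- 1) t) \<noteq> 0" "\<forall>t\<in>B\<^sub>2. gap 0 (zoom \<delta> 1 1 t) \<noteq> 0"
      using R1 R2 B1 B2 by (metis less_irrefl)+
    have "gap s p \<noteq> 0" if "p \<in> P" "s \<in> zoom \<delta> (- 1) (- 1) ` R\<^sub>1 \<union> zoom \<delta> (- 1) 1 ` R\<^sub>2" for p s
      using that unfolding P_def by (elim UnE imageE insertE) (simp_all add: gen neR neR' ne0)
    moreover have "gap p t \<noteq> 0" if "p \<in> P" "t \<in> zoom \<delta> 1 (- 1) ` B\<^sub>1 \<union> zoom \<delta> 1 1 ` B\<^sub>2" for p t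
      using that unfolding P_def by (elim UnE imageE insertE) (simp_all add: gen neB neB' ne0)
    ultimately have generic: "\<forall>p\<in>P. (\<forall>s\<in>zoom \<delta> (- 1) (- 1) ` R\<^sub>1 \<union> zoom \<delta> (- 1) 1 ` R\<^sub>2. gap s p \<noteq> 0) \<and>
        (\<forall>t\<in>zoom \<delta> 1 (- 1) ` B\<^sub>1 \<union> zoom \<delta> 1 1 ` B\<^sub>2. gap p t \<noteq> 0)"
      by blast
    have "finite P" using fin by (simp add: P_def)
    then show ?case
      unfolding unsplittable_def f_def[symmetric] g_def[symmetric] P_def[symmetric] R_def[symmetric] B_def[symmetric]
      using fin generic cardR cardB
      by (intro conjI allI colour) (simp_all only: R_def B_def finite_Un finite_imageI)
  qed
qed

text \<open>
  Double induction on \<open>k\<close> and \<open>l\<close>. If \<open>k = 0\<close>, a single left cap without points suffices, and symmetrically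
  for \<open>l = 0\<close>. The half-turn \<open>uminus\<close> exchanges the kinds of caps and the two copies, so the exposedness of the right
  caps is an instance of that of the left caps.
\<close>
lemma ex_unsplittable_exposed:
  "\<exists>P R B. unsplittable k l P R B \<and> exposed R B \<and> exposed (uminus ` B) (uminus ` R)"
proof (induction k arbitrary: l)
  case 0
  have "unsplittable 0 l {} {0} {}" "exposed {0} {}" "exposed (uminus ` {}) (uminus ` {0})"
    by (auto simp: unsplittable_def exposed_def tame_def adjacent_def)
  then show ?case by blast
next
  case (Suc k)
  show ?case
  proof (induction l)
    case 0
    have "unsplittable (Suc k) 0 {} {} {0}" "exposed {} {0}" "exposed (uminus ` {0}) (uminus ` {})"
      by (auto simp: unsplittable_def exposed_def tame_def adjacent_def)
    then show ?case by blast
  next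
    case (Suc l)
    obtain P\<^sub>1 R\<^sub>1 B\<^sub>1 where 1: "unsplittable k (Suc l) P\<^sub>1 R\<^sub>1 B\<^sub>1"
        "exposed R\<^sub>1 B\<^sub>1" "exposed (uminus ` B\<^sub>1) (uminus ` R\<^sub>1)"
      using \<open>\<And>l. \<exists>P R B. unsplittable k l P R B \<and> exposed R B \<and> exposed (uminus ` B) (uminus ` R)\<close> by blast
    obtain P\<^sub>2 R\<^sub>2 B\<^sub>2 where 2: "unsplittable (Suc k) l P\<^sub>2 R\<^sub>2 B\<^sub>2"
        "exposed R\<^sub>2 B\<^sub>2" "exposed (uminus ` B\<^sub>2) (uminus ` R\<^sub>2)"
      using Suc by blast
    have fin: "finite R\<^sub>1" "finite R\<^sub>2" "finite B\<^sub>1" "finite B\<^sub>2"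
      using 1(1) 2(1) by (auto simp: unsplittable_def)
    have "\<forall>\<^sub>F \<delta> in at_right 0. exposed
        (zoom \<delta> (- 1) (- 1) ` uminus ` B\<^sub>2 \<union> zoom \<delta> (- 1) 1 ` uminus ` B\<^sub>1)
        (zoom \<delta> 1 (- 1) ` uminus ` R\<^sub>2 \<union> zoom \<delta> 1 1 ` uminus ` R\<^sub>1)"
      using fin 1 2 by (intro exposed_zoom) auto
    moreover have "\<forall>\<^sub>F \<delta> in at_right 0. exposed
        (zoom \<delta> (- 1) (- 1) ` R\<^sub>1 \<union> zoom \<delta> (- 1) 1 ` R\<^sub>2) (zoom \<delta> 1 (- 1) ` B\<^sub>1 \<union> zoom \<delta> 1 1 ` B\<^sub>2)"
      using fin 1 2 by (intro exposed_zoom)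
    moreover note unsplittable_zoom[OF 1(1) 2(1)]
    ultimately have "\<forall>\<^sub>F \<delta> in at_right (0::real).
        \<exists>P R B. unsplittable (Suc k) (Suc l) P R B \<and> exposed R B \<and> exposed (uminus ` B) (uminus ` R)"
    proof eventually_elim
      case (elim \<delta>)
      have "uminus ` (zoom \<delta> 1 (- 1) ` B\<^sub>1 \<union> zoom \<delta> 1 1 ` B\<^sub>2) =
          zoom \<delta> (- 1) (- 1) ` uminus ` B\<^sub>2 \<union> zoom \<delta> (- 1) 1 ` uminus ` B\<^sub>1"
        "uminus ` (zoom \<delta> (- 1) (- 1) ` R\<^sub>1 \<union> zoom \<delta> (- 1) 1 ` R\<^sub>2) =
          zoom \<delta> 1 (- 1) ` uminus ` R\<^sub>2 \<union> zoom \<delta> 1 1 ` uminus ` R\<^sub>1"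
        by (simp_all add: image_Un image_image uminus_zoom Un_commute)
      with elim(1) have "exposed (uminus ` (zoom \<delta> 1 (- 1) ` B\<^sub>1 \<union> zoom \<delta> 1 1 ` B\<^sub>2))
          (uminus ` (zoom \<delta> (- 1) (- 1) ` R\<^sub>1 \<union> zoom \<delta> (- 1) 1 ` R\<^sub>2))"
        by (simp only:)
      with elim(2,3) show ?case by blast
    qed
    then show ?case
      using eventually_happens'[OF trivial_limit_at_right_real] by blast
  qed
qed

section \<open>Caps that avoid an exposed set\<close>

text \<open>
  Here \<open>z\<close> and the points of \<open>R\<close> are at level \<open>-1\<close>, and \<open>q\<close> is the centre of a disk to their left (level \<open>-2\<close>) or to
  their right (level \<open>0\<close>) that contains \<open>z\<close> but no point of \<open>R\<close>. The disks on the left are far from \<open>B\<close>, which is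
  at level \<open>1\<close>; those on the right must avoid \<open>B\<close> as well.
\<close>
definition avoidable :: "(real \<times> real) set \<Rightarrow> (real \<times> real) set \<Rightarrow> real \<times> real \<Rightarrow> bool" where
  "avoidable R B z \<longleftrightarrow>
     (\<exists>q. gap q z < 0 \<and> (\<forall>r\<in>R. 0 < gap q r)) \<or>
     (\<exists>q. gap z q < 0 \<and> (\<forall>r\<in>R. 0 < gap r q) \<and> (\<forall>b\<in>B. 0 < gap q b))"

text \<open>
  On the chord through \<open>s\<close> and \<open>t\<close>, the boundary of the cap with apex \<open>cross s t\<close> is offset by the
  quadratic polynomial that vanishes at the two end points.
\<close>
lemma gap_cross:
  assumes "snd s \<noteq> snd t"
  shows "gap z (cross s t) =
    fst s + slope s t * (snd z - snd s) - fst z + (snd z - snd s) * (snd z - snd t) / 2"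
  unfolding gap_def cross_def Let_def fst_conv snd_conv
  by (simp add: field_simps power2_eq_square)

lemma chord_bound:
  assumes "tame R" "adjacent R s t" "r \<in> R"
  shows "\<bar>fst s + slope s t * (snd r - snd s) - fst r\<bar> \<le> (snd r - snd s) * (snd r - snd t) / 2"
proof -
  have st: "s \<in> R" "t \<in> R" "snd s < snd t" and none: "\<not> (snd s < snd r \<and> snd r < snd t)"
    using assms by (auto simp: adjacent_def)
  have inj: "inj_on snd R" using assms(1) by (simp add: tame_def)
  have along: "fst v = fst u + slope u v * (snd v - snd u)" if "snd u < snd v" for u v
    using that by (simp add: slope_def)
  consider "r = s" | "r = t" | "snd r < snd s" | "snd t < snd r"
    using none inj st(1,2) assms(3) by (metis inj_onD linorder_neqE_linordered_idom)
  then show ?thesis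
  proof cases
    case 1
    then show ?thesis by simp
  next
    case 2
    then show ?thesis using along[OF st(3)] by simp
  next
    case 3
    have "\<bar>slope s t - slope r s\<bar> < (snd t - snd r) / 2"
      using assms st 3 unfolding tame_def by blast
    then have "\<bar>slope s t - slope r s\<bar> * (snd s - snd r) \<le> (snd t - snd r) / 2 * (snd s - snd r)"
      using 3 by (intro mult_right_mono) auto
    also have "\<dots> = (snd r - snd s) * (snd r - snd t) / 2"
      by (simp add: field_simps)
    finally have "\<bar>- ((slope s t - slope r s) * (snd s - snd r))\<bar> \<le> (snd r - snd s) * (snd r - snd t) / 2"
      using 3 by (simp add: abs_mult)
    moreover have "- ((slope s t - slope r s) * (snd s - snd r)) = fst s + slope s t * (snd r - snd s) - fst r"
      using along[OF 3] by (simp add: algebra_simps)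
    ultimately show ?thesis by (simp only:)
  next
    case 4
    have "\<bar>slope t r - slope s t\<bar> < (snd r - snd s) / 2"
      using assms st 4 unfolding tame_def by blast
    then have "\<bar>slope t r - slope s t\<bar> * (snd r - snd t) \<le> (snd r - snd s) / 2 * (snd r - snd t)"
      using 4 by (intro mult_right_mono) auto
    also have "\<dots> = (snd r - snd s) * (snd r - snd t) / 2"
      by (simp add: field_simps)
    finally have "\<bar>- ((slope t r - slope s t) * (snd r - snd t))\<bar> \<le> (snd r - snd s) * (snd r - snd t) / 2"
      using 4 by (simp add: abs_mult)
    moreover have "- ((slope t r - slope s t) * (snd r - snd t)) = fst s + slope s t * (snd r - snd s) - fst r"
      using along[OF 4] along[OF st(3)] by (simp add: algebra_simps)
    ultimately show ?thesis by (simp only:)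
  qed
qed

lemma eventually_less_at_right: "\<forall>\<^sub>F \<tau> in at_right 0. \<tau> < (c::real)" if "0 < c"
  using that by (auto simp: eventually_at_right_field)

text \<open>
  A point on or to the right of the chord from \<open>s\<close> to \<open>t\<close> lies inside the right cap through \<open>s\<close> and \<open>t\<close>, and a
  point on or to the left of it inside the left cap; shifting the cap slightly away from the chord frees \<open>R\<close> while
  it still contains the point.
\<close>
lemma avoidable_between:
  assumes fin: "finite R" "finite B" and ex: "exposed R B" and adj: "adjacent R s t"
    and z: "snd s \<le> snd z" "snd z < snd t" "z \<noteq> s"
  shows "avoidable R B z"
proof -
  have tame: "tame R" and st: "snd s < snd t"
    using ex adj by (auto simp: exposed_def adjacent_def)
  define x where "x = fst s + slope s t * (snd z - snd s)"
  define w where "w = (snd z - snd s) * (snd z - snd t) / 2"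
  have w: "w \<le> 0" "snd z \<noteq> snd s \<Longrightarrow> w < 0"
    using z by (auto simp: w_def mult_le_0_iff mult_less_0_iff)
  have "x - fst z + w < 0 \<or> fst z - x + w < 0"
  proof (cases "snd z = snd s")
    case True
    then have "fst z \<noteq> fst s" "x = fst s" using z(3) by (auto simp: x_def prod_eq_iff)
    then show ?thesis using w(1) by linarith
  next
    case False
    then show ?thesis using w(2) by linarith
  qed
  then show ?thesis
  proof
    assume right: "x - fst z + w < 0"
    let ?c = "cross s t"
    have c: "gap z ?c < 0" using right st by (simp add: gap_cross x_def w_def)
    have cr: "0 \<le> gap r ?c" if "r \<in> R" for r
      using chord_bound[OF tame adj that] unfolding gap_cross[OF less_imp_neq[OF st]] by linarith
    have cb: "0 < gap ?c b" if "b \<in> B" for b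
      using ex adj that unfolding exposed_def by blast
    have "\<forall>\<^sub>F \<tau> in at_right 0. 0 < \<tau> \<and> \<tau> < - gap z ?c \<and> (\<forall>b\<in>B. \<tau> < gap ?c b)"
      using fin c cb
      by (intro eventually_conj eventually_ball_finite ballI eventually_less_at_right)
         (auto simp: eventually_at_right_less)
    then obtain \<tau> where \<tau>: "0 < \<tau>" "\<tau> < - gap z ?c" "\<forall>b\<in>B. \<tau> < gap ?c b"
      using eventually_happens'[OF trivial_limit_at_right_real] by blast
    have shift: "gap u (?c + (\<tau>, 0)) = gap u ?c + \<tau>" "gap (?c + (\<tau>, 0)) u = gap ?c u - \<tau>" for u
      by (simp_all add: gap_def)
    have "\<forall>r\<in>R. 0 < gap r (?c + (\<tau>, 0))"
      using cr \<tau>(1) by (auto simp only: shift intro: add_nonneg_pos)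
    then show ?thesis
      unfolding avoidable_def using \<tau> by (intro disjI2 exI[of _ "?c + (\<tau>, 0)"]) (simp add: shift)
  next
    assume left: "fst z - x + w < 0"
    \<comment> \<open>the apex of the left cap through \<open>s\<close> and \<open>t\<close>, obtained by a half-turn\<close>
    let ?c = "- cross (- s) (- t)"
    have sl: "slope (- s) (- t) = slope s t" using st by (simp add: slope_def divide_simps) (simp add: algebra_simps)
    have gc: "gap ?c u = fst u - (fst s + slope s t * (snd u - snd s)) + (snd u - snd s) * (snd u - snd t) / 2" for u
      using gap_cross[of "- s" "- t" "- u"] gap_uminus[of "- ?c" "- u"] st
      by (simp add: sl gap_uminus algebra_simps)
    have c: "gap ?c z < 0" using left by (simp add: gc x_def w_def)
    have cr: "0 \<le> gap ?c r" if "r \<in> R" for r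
      using chord_bound[OF tame adj that] unfolding gc by linarith
    \<comment> \<open>half of the slack at \<open>z\<close>\<close>
    define \<tau> where "\<tau> = - gap ?c z / 2"
    have \<tau>: "0 < \<tau>" "\<tau> < - gap ?c z" using c by (auto simp: \<tau>_def)
    have shift: "gap (?c - (\<tau>, 0)) u = gap ?c u + \<tau>" for u
      by (simp add: gap_def)
    have "\<forall>r\<in>R. 0 < gap (?c - (\<tau>, 0)) r"
      using cr \<tau>(1) by (auto simp only: shift intro: add_nonneg_pos)
    then show ?thesis
      unfolding avoidable_def using \<tau> by (intro disjI1 exI[of _ "?c - (\<tau>, 0)"]) (simp add: shift)
  qed
qed

lemma eventually_affine_pos:
  assumes "0 < k" shows "\<forall>\<^sub>F c in at_top. 0 < a + k * (c::real)"
  using eventually_gt_at_top[of "- a / k"]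
  by eventually_elim (use assms in \<open>simp add: field_simps\<close>)

text \<open>
  At the height of the topmost point of \<open>R\<close>, a cap whose apex is very far up has such a steep boundary that, if it
  separates \<open>z\<close> from the topmost point, it avoids all lower points of \<open>R\<close> and all of \<open>B\<close>.
\<close>
lemma avoidable_at_top:
  assumes fin: "finite R" "finite B" and inj: "inj_on snd R"
    and s: "s \<in> R" "\<forall>r\<in>R. snd r \<le> snd s" and z: "snd z = snd s" "z \<noteq> s"
  shows "avoidable R B z"
proof -
  define m where "m = (fst z + fst s) / 2"
  have steep: "\<forall>\<^sub>F c in at_top. 0 < d + ((snd r - c)\<^sup>2 - (snd s - c)\<^sup>2) / 2"
    if r: "r \<in> R" and d: "r = s \<Longrightarrow> 0 < d" for r and d :: real
  proof (cases "r = s")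
    case True
    then show ?thesis using d by simp
  next
    case False
    then have "0 < snd s - snd r" using s r inj by (metis diff_gt_0_iff_gt inj_onD order_less_le)
    from eventually_affine_pos[OF this, of "d + ((snd r)\<^sup>2 - (snd s)\<^sup>2) / 2"]
    show ?thesis by eventually_elim (simp add: power2_eq_square field_simps)
  qed
  have "fst z < fst s \<or> fst s < fst z" using z by (auto simp: prod_eq_iff)
  then show ?thesis
  proof
    assume lt: "fst z < fst s"
    have "\<forall>\<^sub>F c in at_top. \<forall>r\<in>R. 0 < fst r - m + ((snd r - c)\<^sup>2 - (snd s - c)\<^sup>2) / 2"
      using fin lt by (intro eventually_ball_finite ballI steep) (auto simp: m_def)
    then obtain c where "\<forall>r\<in>R. 0 < fst r - m + ((snd r - c)\<^sup>2 - (snd s - c)\<^sup>2) / 2"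
      using eventually_happens'[OF trivial_limit_at_top_linorder] by blast
    then show ?thesis
      unfolding avoidable_def using lt z(1)
      by (intro disjI1 exI[of _ "(m + (snd s - c)\<^sup>2 / 2, c)"]) (auto simp: gap_def m_def algebra_simps diff_divide_distrib)
  next
    assume lt: "fst s < fst z"
    have "\<forall>\<^sub>F c in at_top. (\<forall>r\<in>R. 0 < (m - fst r) + ((snd r - c)\<^sup>2 - (snd s - c)\<^sup>2) / 2) \<and>
        (\<forall>b\<in>B. 0 < (2 * (fst b - m) - snd s) + 1 * c) \<and> snd s + 1 \<le> c"
      using fin lt
      by (intro eventually_conj eventually_ball_finite ballI steep eventually_affine_pos eventually_ge_at_top)
         (auto simp: m_def)
    then obtain c where c: "\<forall>r\<in>R. 0 < (m - fst r) + ((snd r - c)\<^sup>2 - (snd s - c)\<^sup>2) / 2"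
        "\<forall>b\<in>B. 0 < (2 * (fst b - m) - snd s) + 1 * c" "snd s + 1 \<le> c"
      using eventually_happens'[OF trivial_limit_at_top_linorder] by blast
    have sq: "c - snd s \<le> (snd s - c)\<^sup>2"
      using c(3) mult_right_mono[of 1 "c - snd s" "c - snd s"] by (simp add: power2_eq_square algebra_simps)
    have "0 < fst b - (m - (snd s - c)\<^sup>2 / 2) + (snd b - c)\<^sup>2 / 2" if "b \<in> B" for b
    proof -
      have *: "0 < e - (m - p / 2) + q / 2"
        if "0 < (2 * (e - m) - snd s) + 1 * c" "0 \<le> q" "c - snd s \<le> p" for e p q :: real
        using that by (simp add: field_simps)
      show ?thesis by (rule *) (use c(2) that sq in auto)
    qed
    then show ?thesis
      unfolding avoidable_def using lt z(1) c(1)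
      by (intro disjI2 exI[of _ "(m - (snd s - c)\<^sup>2 / 2, c)"])
         (auto simp: gap_def m_def power2_commute[of c] algebra_simps diff_divide_distrib)
  qed
qed

lemma avoidable_if_exposed:
  assumes fin: "finite R" "finite B" and ex: "exposed R B" and z: "z \<notin> R"
    and st: "s \<in> R" "snd s \<le> snd z" "t \<in> R" "snd z \<le> snd t"
  shows "avoidable R B z"
proof -
  let ?L = "{r\<in>R. snd r \<le> snd z}" and ?U = "{r\<in>R. snd z < snd r}"
  have "s \<in> ?L" using st by simp
  then have "finite (snd ` ?L)" "snd ` ?L \<noteq> {}" using fin by (simp, blast)
  from Max_in[OF this] obtain s' where "s' \<in> ?L" "snd s' = Max (snd ` ?L)" by auto
  with Max_ge[OF \<open>finite (snd ` ?L)\<close>]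
  have s': "s' \<in> R" "snd s' \<le> snd z" "\<And>r. r \<in> R \<Longrightarrow> snd r \<le> snd z \<Longrightarrow> snd r \<le> snd s'" by auto
  show ?thesis
  proof (cases "?U = {}")
    case True
    then have top: "snd r \<le> snd z" if "r \<in> R" for r
      using that by (blast intro: leI)
    then have "snd t \<le> snd s'" using s'(3) st(3) by blast
    then have eq: "snd z = snd s'" using s'(2) st(4) by linarith
    have "inj_on snd R" using ex by (simp add: exposed_def tame_def)
    moreover have "\<forall>r\<in>R. snd r \<le> snd s'" using top unfolding eq by blast
    moreover have "z \<noteq> s'" using s'(1) z by blast
    ultimately show ?thesis
      by (rule avoidable_at_top[OF fin _ s'(1) _ eq])
  next
    case False
    have "finite (snd ` ?U)" "snd ` ?U \<noteq> {}" using fin False by (simp, blast)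
    from Min_in[OF this] obtain t' where "t' \<in> ?U" "snd t' = Min (snd ` ?U)" by auto
    with Min_le[OF \<open>finite (snd ` ?U)\<close>]
    have t': "t' \<in> R" "snd z < snd t'" "\<And>r. r \<in> R \<Longrightarrow> snd z < snd r \<Longrightarrow> snd t' \<le> snd r" by auto
    have "adjacent R s' t'"
      unfolding adjacent_def
    proof (intro conjI ballI notI)
      fix r assume "r \<in> R" "snd s' < snd r \<and> snd r < snd t'"
      then show False using s'(3)[of r] t'(3)[of r] by linarith
    qed (use s' t' in auto)
    moreover have "z \<noteq> s'" using s'(1) z by blast
    ultimately show ?thesis
      by (rule avoidable_between[OF fin ex _ s'(2) t'(2)])
  qed
qed

section \<open>From caps to unit disks\<close>

text \<open>
  The deformation of \<open>gap\<close> that governs true unit disks at scale \<open>\<epsilon>\<close>: the squared distance of two points placed at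
  consecutive levels is \<open>1 + \<epsilon>\<^sup>2 * bent \<epsilon> u v\<close>.
\<close>
definition bent :: "real \<Rightarrow> real \<times> real \<Rightarrow> real \<times> real \<Rightarrow> real" where
  "bent \<epsilon> u v = 2 * (fst v - fst u) + (snd v - snd u)\<^sup>2 + \<epsilon>\<^sup>2 * (fst v - fst u)\<^sup>2"

lemma bent_0: "bent 0 u v = 2 * gap u v"
  by (simp add: bent_def gap_def)

lemma continuous_on_bent [continuous_intros]:
  "continuous_on A e \<Longrightarrow> continuous_on A f \<Longrightarrow> continuous_on A g \<Longrightarrow> continuous_on A (\<lambda>x. bent (e x) (f x) (g x))"
  unfolding bent_def by (intro continuous_intros)

definition place :: "real \<Rightarrow> real \<Rightarrow> real \<times> real \<Rightarrow> real ^ 2" where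
  "place n \<epsilon> u = vector [n + \<epsilon>\<^sup>2 * fst u, \<epsilon> * snd u]"

lemma place_nth [simp]: "place n \<epsilon> u $ 1 = n + \<epsilon>\<^sup>2 * fst u" "place n \<epsilon> u $ 2 = \<epsilon> * snd u"
  by (simp_all add: place_def)

lemma uminus_place: "- place n \<epsilon> u = place (- n) \<epsilon> (- u)"
  by (simp add: vec_eq_iff forall_2)

lemma dist_less_1_iff: "dist x y < 1 \<longleftrightarrow> (x $ 1 - y $ 1)\<^sup>2 + (x $ 2 - y $ 2)\<^sup>2 < 1"
  and dist_greater_1_iff: "1 < dist x y \<longleftrightarrow> 1 < (x $ 1 - y $ 1)\<^sup>2 + (x $ 2 - y $ 2)\<^sup>2"
  for x y :: "real ^ 2"
  by (simp_all add: dist_vec_def L2_set_def sum_2 dist_real_def)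

lemma dist_place:
  assumes "n' = n + 1" "0 < \<epsilon>"
  shows "dist (place n \<epsilon> u) (place n' \<epsilon> v) < 1 \<longleftrightarrow> bent \<epsilon> u v < 0"
    and "1 < dist (place n \<epsilon> u) (place n' \<epsilon> v) \<longleftrightarrow> 0 < bent \<epsilon> u v"
proof -
  have "(place n \<epsilon> u $ 1 - place n' \<epsilon> v $ 1)\<^sup>2 + (place n \<epsilon> u $ 2 - place n' \<epsilon> v $ 2)\<^sup>2 = 1 + \<epsilon>\<^sup>2 * bent \<epsilon> u v"
    by (simp add: bent_def assms(1) power2_eq_square algebra_simps)
  then show "dist (place n \<epsilon> u) (place n' \<epsilon> v) < 1 \<longleftrightarrow> bent \<epsilon> u v < 0"
    "1 < dist (place n \<epsilon> u) (place n' \<epsilon> v) \<longleftrightarrow> 0 < bent \<epsilon> u v"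
    using assms(2) by (simp_all only: dist_less_1_iff dist_greater_1_iff) (simp_all add: mult_less_0_iff zero_less_mult_iff)
qed

definition avoiding_disk :: "(real ^ 2) set \<Rightarrow> real ^ 2 \<Rightarrow> bool" where
  "avoiding_disk S z \<longleftrightarrow> (\<exists>c. dist c z < 1 \<and> (\<forall>s\<in>S. 1 < dist c s))"

lemma avoiding_diskI: "dist c z < 1 \<Longrightarrow> (\<And>s. s \<in> S \<Longrightarrow> 1 < dist c s) \<Longrightarrow> avoiding_disk S z"
  by (auto simp: avoiding_disk_def)

lemma avoiding_disk_uminus: "avoiding_disk (uminus ` S) (- z) \<longleftrightarrow> avoiding_disk S z"
proof -
  have "avoiding_disk S z" if av: "avoiding_disk (uminus ` S) (- z)" for S z
  proof -
    obtain c where c: "dist c (- z) < 1" "\<forall>s\<in>S. 1 < dist c (- s)"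
      using av unfolding avoiding_disk_def by blast
    have "dist c (- y) = dist (- c) y" for y
      using dist_minus[of c "- y"] by simp
    then show ?thesis using c unfolding avoiding_disk_def by (intro exI[of _ "- c"]) simp
  qed
  from this[of S z] this[of "uminus ` S" "- z"] show ?thesis
    by (auto simp: image_image)
qed

lemma less_distI:
  fixes x y :: "real ^ 'n"
  assumes "1 < \<bar>x $ i - y $ i\<bar>"
  shows "1 < dist x y"
  using component_le_norm_cart[of "x - y" i] assms by (simp add: dist_norm)

section \<open>Covering the plane\<close>

text \<open>
  For \<open>\<epsilon> = 0\<close> every point of the relevant compact region \<open>K\<close> is avoidable or belongs to \<open>R\<close>, where the
  cap contains \<open>k\<close> points of \<open>P\<close>. All conditions involved are strict inequalities, so they hold on an open
  neighbourhood of \<open>{0} \<times> K\<close>, which by compactness contains \<open>{\<epsilon>} \<times> K\<close> for all small \<open>\<epsilon>\<close>.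
\<close>
lemma eventually_covered_near:
  fixes P R B :: "(real \<times> real) set" and C :: real
  assumes fin: "finite P" "finite R" "finite B" and ex: "exposed R B"
    and k: "\<forall>s\<in>R. k \<le> card {p\<in>P. gap s p < 0}"
  shows "\<forall>\<^sub>F \<epsilon> in at_right 0. \<forall>w. \<bar>fst w\<bar> \<le> C \<longrightarrow> (\<exists>s\<in>R. snd s \<le> snd w) \<longrightarrow> (\<exists>t\<in>R. snd w \<le> snd t) \<longrightarrow>
    avoiding_disk (place (- 1) \<epsilon> ` R \<union> place 1 \<epsilon> ` B) (place (- 1) \<epsilon> w) \<or>
    k \<le> card {p\<in>P. dist (place 0 \<epsilon> p) (place (- 1) \<epsilon> w) < 1}"
proof -
  define K where "K = (\<Union>s\<in>R. \<Union>t\<in>R. {- C..C} \<times> {snd s..snd t})"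
  have K: "compact ({0::real} \<times> K)"
    unfolding K_def using fin by (intro compact_Times compact_UN compact_Icc) auto
  define left where "left q = {w::real \<times> real \<times> real. bent (fst w) q (snd w) < 0 \<and>
     (\<forall>r\<in>R. 0 < bent (fst w) q r) \<and> (\<forall>b\<in>B. 0 < 2 + (fst w)\<^sup>2 * (fst b - fst q))}" for q
  define right where "right q = {w::real \<times> real \<times> real. bent (fst w) (snd w) q < 0 \<and>
     (\<forall>r\<in>R. 0 < bent (fst w) r q) \<and> (\<forall>b\<in>B. 0 < bent (fst w) q b)}" for q
  define near where "near s = {w::real \<times> real \<times> real. \<forall>p\<in>{p\<in>P. gap s p < 0}. bent (fst w) (snd w) p < 0}" for s
  define W where "W = (\<Union>q. left q) \<union> (\<Union>q. right q) \<union> (\<Union>s\<in>R. near s)"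
  \<comment> \<open>so that universal conditions over finite sets are recognized as open\<close>
  have ball: "{w. \<forall>r\<in>A. Q r w} = (\<Inter>r\<in>A. {w. Q r w})" for A :: "(real \<times> real) set" and Q :: "_ \<Rightarrow> real \<times> real \<times> real \<Rightarrow> bool"
    by auto
  have "open (left q)" "open (right q)" for q
    unfolding left_def right_def ball using fin
    by (intro open_Collect_conj; (unfold ball)?; intro open_INT ballI open_Collect_less continuous_intros; simp)+
  moreover have "open (near s)" for s
    unfolding near_def ball using fin
    by (intro open_INT ballI open_Collect_less continuous_intros) auto
  ultimately have "open W" unfolding W_def by (intro open_Un open_UN ballI)
  moreover have "{0} \<times> K \<subseteq> W"
  proof
    fix w :: "real \<times> real \<times> real" assume "w \<in> {0} \<times> K"
    then have w: "fst w = 0" and "snd w \<in> K" by auto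
    then obtain s t where st: "s \<in> R" "t \<in> R" "snd s \<le> snd (snd w)" "snd (snd w) \<le> snd t"
      by (auto simp: K_def)
    show "w \<in> W"
    proof (cases "snd w \<in> R")
      case True
      then have "w \<in> near (snd w)" by (simp add: near_def w bent_0)
      with True show ?thesis by (auto simp: W_def)
    next
      case False
      have "avoidable R B (snd w)"
        by (rule avoidable_if_exposed[OF fin(2,3) ex False st(1,3,2,4)])
      then obtain q where "w \<in> left q \<or> w \<in> right q"
        unfolding avoidable_def left_def right_def by (auto simp: w bent_0)
      then show ?thesis unfolding W_def by blast
    qed
  qed
  ultimately obtain e where e: "0 < e" "(\<Union>x\<in>{0} \<times> K. ball x e) \<subseteq> W"
    using compact_subset_open_imp_ball_epsilon_subset[OF K] by blast
  have "\<forall>\<^sub>F \<epsilon> in at_right 0. 0 < \<epsilon> \<and> \<epsilon> < e"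
    using e(1) by (auto simp: eventually_at_right_field)
  then show ?thesis
  proof (eventually_elim, intro allI impI)
    fix \<epsilon> :: real and w :: "real \<times> real"
    assume \<epsilon>: "0 < \<epsilon> \<and> \<epsilon> < e" and w: "\<bar>fst w\<bar> \<le> C" "\<exists>s\<in>R. snd s \<le> snd w" "\<exists>t\<in>R. snd w \<le> snd t"
    have "w \<in> K"
      using w unfolding K_def by (cases w) auto
    moreover have "(\<epsilon>, w) \<in> ball (0, w) e"
      using \<epsilon> by (simp add: dist_Pair_Pair)
    ultimately have "(\<epsilon>, w) \<in> W" using e(2) by blast
    then consider q where "(\<epsilon>, w) \<in> left q" | q where "(\<epsilon>, w) \<in> right q" | s where "s \<in> R" "(\<epsilon>, w) \<in> near s"
      by (auto simp: W_def)
    then show "avoiding_disk (place (- 1) \<epsilon> ` R \<union> place 1 \<epsilon> ` B) (place (- 1) \<epsilon> w) \<or>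
      k \<le> card {p\<in>P. dist (place 0 \<epsilon> p) (place (- 1) \<epsilon> w) < 1}"
    proof cases
      case 1
      have "avoiding_disk (place (- 1) \<epsilon> ` R \<union> place 1 \<epsilon> ` B) (place (- 1) \<epsilon> w)"
      proof (rule avoiding_diskI[of "place (- 2) \<epsilon> q"])
        show "dist (place (- 2) \<epsilon> q) (place (- 1) \<epsilon> w) < 1"
          using 1 \<epsilon> by (simp add: dist_place left_def)
        fix s assume "s \<in> place (- 1) \<epsilon> ` R \<union> place 1 \<epsilon> ` B"
        then show "1 < dist (place (- 2) \<epsilon> q) s"
        proof (elim UnE imageE)
          fix r assume "r \<in> R" "s = place (- 1) \<epsilon> r"
          then show ?thesis using 1 \<epsilon> by (simp add: dist_place left_def)
        next
          fix b assume b: "b \<in> B" "s = place 1 \<epsilon> b"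
          then have "0 < 2 + \<epsilon>\<^sup>2 * (fst b - fst q)" using 1 by (simp add: left_def)
          then show ?thesis unfolding b(2)
            by (intro less_distI[where i = 1]) (simp add: algebra_simps)
        qed
      qed
      then show ?thesis ..
    next
      case 2
      have "avoiding_disk (place (- 1) \<epsilon> ` R \<union> place 1 \<epsilon> ` B) (place (- 1) \<epsilon> w)"
      proof (rule avoiding_diskI[of "place 0 \<epsilon> q"])
        show "dist (place 0 \<epsilon> q) (place (- 1) \<epsilon> w) < 1"
          using 2 \<epsilon> by (simp add: dist_commute[of "place 0 \<epsilon> q"] dist_place right_def)
        fix s assume "s \<in> place (- 1) \<epsilon> ` R \<union> place 1 \<epsilon> ` B"
        then show "1 < dist (place 0 \<epsilon> q) s"
        proof (elim UnE imageE)
          fix r assume "r \<in> R" "s = place (- 1) \<epsilon> r"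
          then show ?thesis using 2 \<epsilon> by (simp add: dist_commute[of "place 0 \<epsilon> q"] dist_place right_def)
        next
          fix b assume "b \<in> B" "s = place 1 \<epsilon> b"
          then show ?thesis using 2 \<epsilon> by (simp add: dist_place right_def)
        qed
      qed
      then show ?thesis ..
    next
      case 3
      have "k \<le> card {p\<in>P. gap s p < 0}" using k 3(1) by blast
      also have "\<dots> \<le> card {p\<in>P. dist (place 0 \<epsilon> p) (place (- 1) \<epsilon> w) < 1}"
        using 3(2) \<epsilon> fin(1)
        by (intro card_mono) (auto simp: near_def dist_commute[of "place 0 \<epsilon> _"] dist_place)
      finally show ?thesis ..
    qed
  qed
qed

text \<open>
  A point above or below all of the red centres is covered by the disk that has it as its lowest or highest point, and
  a point to the left of them by the disk that has it as its rightmost point, each shifted slightly. A point to the right of them is in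
  a disk around \<open>(0, 3 * C)\<close> in the scaled coordinates, which is far outside all caps. Only the points close to the
  red centres remain.
\<close>
lemma eventually_covered_left:
  fixes P R B :: "(real \<times> real) set"
  assumes fin: "finite P" "finite R" "finite B" and ex: "exposed R B"
    and k: "\<forall>s\<in>R. k \<le> card {p\<in>P. gap s p < 0}"
  shows "\<forall>\<^sub>F \<epsilon> in at_right 0. \<forall>z::real ^ 2. z $ 1 \<le> - 1 / 2 \<longrightarrow>
    avoiding_disk (place (- 1) \<epsilon> ` R \<union> place 1 \<epsilon> ` B) z \<or>
    k \<le> card {p\<in>P. dist (place 0 \<epsilon> p) z < 1}"
proof -
  have "finite (fst ` (R \<union> B) \<union> snd ` (R \<union> B))" using fin by simp
  then obtain C\<^sub>0 where C\<^sub>0: "\<forall>x\<in>fst ` (R \<union> B) \<union> snd ` (R \<union> B). norm x \<le> C\<^sub>0"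
    using finite_imp_bounded bounded_iff by metis
  define C where "C = max 1 C\<^sub>0"
  have C: "1 \<le> C" and bound: "\<And>u. u \<in> R \<union> B \<Longrightarrow> \<bar>fst u\<bar> \<le> C" "\<And>u. u \<in> R \<union> B \<Longrightarrow> \<bar>snd u\<bar> \<le> C"
    using C\<^sub>0 unfolding C_def by (simp, metis UnCI imageI le_max_iff_disj real_norm_def)+
  have "\<forall>\<^sub>F \<epsilon> in at_right 0. (0::real) < \<epsilon>"
    by (simp add: eventually_at_right_less)
  moreover have "\<forall>\<^sub>F \<epsilon> in at_right 0. \<epsilon>\<^sup>2 * C < 1 / 4"
  proof -
    have "((\<lambda>\<epsilon>. \<epsilon>\<^sup>2 * C) \<longlongrightarrow> 0) (at_right 0)"
      by (rule tendsto_eq_intros refl | (simp; fail))+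
    from order_tendstoD(2)[OF this, of "1 / 4"] show ?thesis by simp
  qed
  moreover note eventually_covered_near[OF fin ex k, of "16 * C\<^sup>2"]
  ultimately show ?thesis
  proof (eventually_elim, intro allI impI)
    fix \<epsilon> :: real and z :: "real ^ 2"
    assume \<epsilon>: "0 < \<epsilon>" and small: "\<epsilon>\<^sup>2 * C < 1 / 4" and z: "z $ 1 \<le> - 1 / 2"
      and near: "\<forall>w. \<bar>fst w\<bar> \<le> 16 * C\<^sup>2 \<longrightarrow> (\<exists>s\<in>R. snd s \<le> snd w) \<longrightarrow> (\<exists>t\<in>R. snd w \<le> snd t) \<longrightarrow>
        avoiding_disk (place (- 1) \<epsilon> ` R \<union> place 1 \<epsilon> ` B) (place (- 1) \<epsilon> w) \<or>
        k \<le> card {p\<in>P. dist (place 0 \<epsilon> p) (place (- 1) \<epsilon> w) < 1}"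
    let ?S = "place (- 1) \<epsilon> ` R \<union> place 1 \<epsilon> ` B"
    have shiftB: "3 / 4 < 1 + \<epsilon>\<^sup>2 * fst b" if "b \<in> B" for b
    proof -
      have "\<epsilon>\<^sup>2 * (- C) \<le> \<epsilon>\<^sup>2 * fst b"
        using bound(1)[of b] that by (intro mult_left_mono) auto
      then show ?thesis using small by simp
    qed
    \<comment> \<open>centred at almost unit distance above (\<open>\<sigma> = 1\<close>) or below (\<open>\<sigma> = -1\<close>) the point\<close>
    have vertical: "avoiding_disk ?S z"
      if \<sigma>: "\<sigma> = 1 \<or> \<sigma> = - 1" and apart: "\<forall>r\<in>R. 0 < \<sigma> * (z $ 2 - \<epsilon> * snd r)" for \<sigma> :: real
    proof -
      have "\<forall>\<^sub>F \<tau> in at_right 0. 0 < \<tau> \<and> \<tau> < 1 \<and> (\<forall>r\<in>R. \<tau> < \<sigma> * (z $ 2 - \<epsilon> * snd r))"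
        using fin apart
        by (intro eventually_conj eventually_ball_finite ballI eventually_less_at_right)
           (auto simp: eventually_at_right_less)
      then obtain \<tau> where \<tau>: "0 < \<tau>" "\<tau> < 1" "\<forall>r\<in>R. \<tau> < \<sigma> * (z $ 2 - \<epsilon> * snd r)"
        using eventually_happens'[OF trivial_limit_at_right_real] by blast
      define c :: "real ^ 2" where "c = vector [z $ 1, z $ 2 + \<sigma> * (1 - \<tau>)]"
      have c: "c $ 1 = z $ 1" "c $ 2 = z $ 2 + \<sigma> * (1 - \<tau>)" by (simp_all add: c_def)
      show ?thesis
      proof (rule avoiding_diskI[of c])
        show "dist c z < 1"
          using \<sigma> \<tau>(1,2) by (auto simp: dist_less_1_iff c power_mult_distrib power_strict_decreasing abs_square_less_1)
        fix s assume "s \<in> ?S"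
        then show "1 < dist c s"
        proof (elim UnE imageE)
          fix r assume r: "r \<in> R" "s = place (- 1) \<epsilon> r"
          then have "\<tau> < \<sigma> * (z $ 2 - \<epsilon> * snd r)" using \<tau>(3) by blast
          then show ?thesis
            unfolding r(2) using \<sigma> by (intro less_distI[where i = 2]) (auto simp: c)
        next
          fix b assume b: "b \<in> B" "s = place 1 \<epsilon> b"
          show ?thesis
            unfolding b(2) using shiftB[OF b(1)] z by (intro less_distI[where i = 1]) (simp add: c)
        qed
      qed
    qed
    \<comment> \<open>the position of \<open>z\<close> in the scaled coordinates around \<open>(-1, 0)\<close>\<close>
    define X Y where "X = (z $ 1 + 1) / \<epsilon>\<^sup>2" and "Y = z $ 2 / \<epsilon>"
    have zXY: "z = place (- 1) \<epsilon> (X, Y)"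
      using \<epsilon> by (simp add: vec_eq_iff forall_2 X_def Y_def)
    have z12: "z $ 1 = - 1 + \<epsilon>\<^sup>2 * X" "z $ 2 = \<epsilon> * Y"
      by (simp_all add: zXY)
    consider "\<forall>r\<in>R. snd r < Y" | "\<forall>r\<in>R. Y < snd r"
      | s t where "s \<in> R" "t \<in> R" "snd s \<le> Y" "Y \<le> snd t"
      by (meson not_le)
    then show "avoiding_disk ?S z \<or> k \<le> card {p\<in>P. dist (place 0 \<epsilon> p) z < 1}"
    proof cases
      case 1
      have "avoiding_disk ?S z"
        by (rule vertical[of 1]) (use 1 \<epsilon> in \<open>auto simp: z12\<close>)
      then show ?thesis ..
    next
      case 2
      have "avoiding_disk ?S z"
        by (rule vertical[of "- 1"]) (use 2 \<epsilon> in \<open>auto simp: z12\<close>)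
      then show ?thesis ..
    next
      case 3
      have Y: "\<bar>Y\<bar> \<le> C" using bound(2)[of s] bound(2)[of t] 3 by auto
      consider "X < - C" | "\<bar>X\<bar> \<le> 16 * C\<^sup>2" | "16 * C\<^sup>2 < X"
      proof -
        have "C \<le> C\<^sup>2" using C by (simp add: power2_eq_square)
        then show ?thesis using that C by (smt (verit))
      qed
      then show ?thesis
      proof cases
        case 1
        then have "0 < \<epsilon>\<^sup>2 * (- C - X)" using \<epsilon> by (intro mult_pos_pos) auto
        then obtain \<tau> where "0 < \<tau>" "\<tau> < min 1 (\<epsilon>\<^sup>2 * (- C - X))"
          using dense[of 0 "min 1 (\<epsilon>\<^sup>2 * (- C - X))"] by auto
        then have \<tau>: "0 < \<tau>" "\<tau> < 1" "\<tau> < \<epsilon>\<^sup>2 * (- C - X)" by auto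
        define c :: "real ^ 2" where "c = vector [z $ 1 - (1 - \<tau>), z $ 2]"
        have c: "c $ 1 = z $ 1 - (1 - \<tau>)" "c $ 2 = z $ 2" by (simp_all add: c_def)
        have "avoiding_disk ?S z"
        proof (rule avoiding_diskI[of c])
          show "dist c z < 1"
            using \<tau>(1,2) by (auto simp: dist_less_1_iff c abs_square_less_1)
          fix s assume "s \<in> ?S"
          then show "1 < dist c s"
          proof (elim UnE imageE)
            fix r assume r: "r \<in> R" "s = place (- 1) \<epsilon> r"
            have "\<epsilon>\<^sup>2 * (- C - X) \<le> \<epsilon>\<^sup>2 * (fst r - X)"
              using bound(1)[of r] r by (intro mult_left_mono) auto
            then have "\<tau> < \<epsilon>\<^sup>2 * fst r - \<epsilon>\<^sup>2 * X" using \<tau>(3) by (simp add: right_diff_distrib)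
            then show ?thesis
              unfolding r(2) by (intro less_distI[where i = 1]) (simp add: c z12)
          next
            fix b assume b: "b \<in> B" "s = place 1 \<epsilon> b"
            show ?thesis
              unfolding b(2) using shiftB[OF b(1)] z \<tau>(2) by (intro less_distI[where i = 1]) (simp add: c)
          qed
        qed
        then show ?thesis ..
      next
        case 2
        have "avoiding_disk ?S (place (- 1) \<epsilon> (X, Y)) \<or>
            k \<le> card {p\<in>P. dist (place 0 \<epsilon> p) (place (- 1) \<epsilon> (X, Y)) < 1}"
          by (rule near[rule_format]) (use 2 3 in \<open>auto simp only: fst_conv snd_conv\<close>)
        then show ?thesis by (simp only: zXY[symmetric])
      next
        case X: 3
        \<comment> \<open>height \<open>3 * C\<close> is at least \<open>2 * C\<close> above \<open>R\<close> and \<open>B\<close>, and at most \<open>4 * C\<close> above \<open>z\<close>, whence the bound \<open>16 * C\<^sup>2\<close>\<close>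
        let ?c = "(0, 3 * C)"
        have far: "4 * C\<^sup>2 \<le> (3 * C - snd u)\<^sup>2" if "u \<in> R \<union> B" for u
        proof -
          have "2 * C \<le> 3 * C - snd u" using bound(2)[OF that] by linarith
          then have "(2 * C)\<^sup>2 \<le> (3 * C - snd u)\<^sup>2" using C by (intro power_mono) auto
          then show ?thesis by (simp add: power_mult_distrib)
        qed
        have CC: "C \<le> C\<^sup>2" using C by (simp add: power2_eq_square)
        have "avoiding_disk ?S z"
        proof (rule avoiding_diskI[of "place 0 \<epsilon> ?c"])
          have "\<epsilon>\<^sup>2 * X \<le> 1 / 2" using z by (simp add: z12)
          moreover have X0: "0 \<le> X" using X CC C by linarith
          ultimately have "\<epsilon>\<^sup>2 * X * X \<le> 1 / 2 * X" by (intro mult_right_mono)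
          then have "\<epsilon>\<^sup>2 * X\<^sup>2 \<le> X / 2" by (simp add: power2_eq_square)
          moreover have "(3 * C - Y)\<^sup>2 \<le> (4 * C)\<^sup>2"
            using Y C by (intro power_mono) auto
          then have "(3 * C - Y)\<^sup>2 \<le> 16 * C\<^sup>2" by (simp add: power_mult_distrib)
          ultimately have "bent \<epsilon> (X, Y) ?c < 0"
            using X X0 by (simp add: bent_def)
          then show "dist (place 0 \<epsilon> ?c) z < 1"
            using \<epsilon> by (simp add: zXY dist_commute[of "place 0 \<epsilon> ?c"] dist_place)
          fix s assume "s \<in> ?S"
          then show "1 < dist (place 0 \<epsilon> ?c) s"
          proof (elim UnE imageE)
            fix r assume r: "r \<in> R" "s = place (- 1) \<epsilon> r"
            have "0 \<le> \<epsilon>\<^sup>2 * (fst r)\<^sup>2" by simp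
            moreover have "bent \<epsilon> r ?c = (3 * C - snd r)\<^sup>2 - 2 * fst r + \<epsilon>\<^sup>2 * (fst r)\<^sup>2"
              by (simp add: bent_def power2_commute)
            ultimately have "0 < bent \<epsilon> r ?c"
              using far[OF UnI1[OF r(1)]] bound(1)[OF UnI1[OF r(1)]] CC C by linarith
            then show ?thesis
              using \<epsilon> r by (simp add: dist_commute[of "place 0 \<epsilon> ?c"] dist_place)
          next
            fix b assume b: "b \<in> B" "s = place 1 \<epsilon> b"
            have "0 \<le> \<epsilon>\<^sup>2 * (fst b)\<^sup>2" by simp
            moreover have "bent \<epsilon> ?c b = (3 * C - snd b)\<^sup>2 + 2 * fst b + \<epsilon>\<^sup>2 * (fst b)\<^sup>2"
              by (simp add: bent_def power2_commute)
            ultimately have "0 < bent \<epsilon> ?c b"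
              using far[OF UnI2[OF b(1)]] bound(1)[OF UnI2[OF b(1)]] CC C by linarith
            then show ?thesis
              using \<epsilon> b by (simp add: dist_place)
          qed
        qed
        then show ?thesis ..
      qed
    qed
  qed
qed

lemma eventually_bent_iff_gap:
  assumes "gap u v \<noteq> 0"
  shows "\<forall>\<^sub>F \<epsilon> in at_right 0. bent \<epsilon> u v < 0 \<longleftrightarrow> gap u v < 0"
proof -
  have lim: "((\<lambda>\<epsilon>. bent \<epsilon> u v) \<longlongrightarrow> 2 * gap u v) (at_right 0)"
    unfolding bent_def gap_def by (rule tendsto_eq_intros refl | (simp; fail))+
  show ?thesis
  proof (cases "gap u v < 0")
    case True
    then show ?thesis using order_tendstoD(2)[OF lim, of 0] by (simp add: eventually_mono)
  next
    case False
    then have "0 < 2 * gap u v" using assms by simp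
    from order_tendstoD(1)[OF lim this] show ?thesis
      by eventually_elim (use False in auto)
  qed
qed

text \<open>
  The right half of the plane is the left half of the configuration turned by a half-turn. For the strip in the middle
  the disk is chosen half a unit above or below the point, away from the horizontal axis near which all
  special centres are.
\<close>
lemma eventually_covered:
  fixes P R B :: "(real \<times> real) set"
  assumes un: "unsplittable m m P R B" and ex: "exposed R B" "exposed (uminus ` B) (uminus ` R)"
  shows "\<forall>\<^sub>F \<epsilon> in at_right 0. \<forall>z.
    avoiding_disk (place (- 1) \<epsilon> ` R \<union> place 1 \<epsilon> ` B) z \<or> m \<le> card {p\<in>P. dist (place 0 \<epsilon> p) z < 1}"
proof -
  have fin: "finite P" "finite R" "finite B"
    and k: "\<forall>s\<in>R. m \<le> card {p\<in>P. gap s p < 0}" and l: "\<forall>t\<in>B. m \<le> card {p\<in>P. gap p t < 0}"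
    using un by (simp_all add: unsplittable_def)
  have l': "\<forall>s\<in>uminus ` B. m \<le> card {p \<in> uminus ` P. gap s p < 0}"
  proof
    fix s assume "s \<in> uminus ` B"
    then obtain t where t: "t \<in> B" "s = - t" by blast
    have "{p \<in> uminus ` P. gap s p < 0} = uminus ` {p\<in>P. gap p t < 0}"
      unfolding t(2) by (simp add: Compr_image_eq gap_uminus)
    then show "m \<le> card {p \<in> uminus ` P. gap s p < 0}"
      using l t(1) by (simp add: card_image)
  qed
  have fin': "finite (uminus ` P)" "finite (uminus ` B)" "finite (uminus ` R)" using fin by simp_all
  have "\<forall>\<^sub>F \<epsilon> in at_right 0. (0::real) < \<epsilon>"
    by (simp add: eventually_at_right_less)
  moreover have "\<forall>\<^sub>F \<epsilon> in at_right 0. \<forall>u\<in>R \<union> B. \<bar>\<epsilon>\<^sup>2 * fst u\<bar> < 1 / 20 \<and> \<bar>\<epsilon> * snd u\<bar> < 1 / 20"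
  proof (intro eventually_ball_finite ballI eventually_conj)
    fix u :: "real \<times> real"
    have "((\<lambda>\<epsilon>. \<bar>\<epsilon>\<^sup>2 * fst u\<bar>) \<longlongrightarrow> 0) (at_right 0)" "((\<lambda>\<epsilon>. \<bar>\<epsilon> * snd u\<bar>) \<longlongrightarrow> 0) (at_right 0)"
      by (rule tendsto_eq_intros refl | (simp; fail))+
    from order_tendstoD(2)[OF this(1), of "1 / 20"] order_tendstoD(2)[OF this(2), of "1 / 20"]
    show "\<forall>\<^sub>F \<epsilon> in at_right 0. \<bar>\<epsilon>\<^sup>2 * fst u\<bar> < 1 / 20" "\<forall>\<^sub>F \<epsilon> in at_right 0. \<bar>\<epsilon> * snd u\<bar> < 1 / 20"
      by simp_all
  qed (use fin in auto)
  moreover note eventually_covered_left[OF fin ex(1) k] eventually_covered_left[OF fin' ex(2) l']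
  ultimately show ?thesis
  proof (eventually_elim, intro allI)
    fix \<epsilon> :: real and z :: "real ^ 2"
    let ?S = "place (- 1) \<epsilon> ` R \<union> place 1 \<epsilon> ` B"
    assume "0 < \<epsilon>" and small: "\<forall>u\<in>R \<union> B. \<bar>\<epsilon>\<^sup>2 * fst u\<bar> < 1 / 20 \<and> \<bar>\<epsilon> * snd u\<bar> < 1 / 20"
      and left: "\<forall>z::real ^ 2. z $ 1 \<le> - 1 / 2 \<longrightarrow> avoiding_disk ?S z \<or> m \<le> card {p\<in>P. dist (place 0 \<epsilon> p) z < 1}"
      and right: "\<forall>z::real ^ 2. z $ 1 \<le> - 1 / 2 \<longrightarrow>
        avoiding_disk (place (- 1) \<epsilon> ` uminus ` B \<union> place 1 \<epsilon> ` uminus ` R) z \<or>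
        m \<le> card {p \<in> uminus ` P. dist (place 0 \<epsilon> p) z < 1}"
    consider "z $ 1 \<le> - 1 / 2" | "1 / 2 \<le> z $ 1" | "\<bar>z $ 1\<bar> < 1 / 2" by linarith
    then show "avoiding_disk ?S z \<or> m \<le> card {p\<in>P. dist (place 0 \<epsilon> p) z < 1}"
    proof cases
      case 1
      then show ?thesis using left by blast
    next
      case 2
      have "place (- 1) \<epsilon> ` uminus ` B \<union> place 1 \<epsilon> ` uminus ` R = uminus ` ?S"
        by (simp add: image_Un image_image uminus_place Un_commute)
      moreover have "dist (place 0 \<epsilon> (- p)) (- z) = dist (place 0 \<epsilon> p) z" for p
        using uminus_place[of 0 \<epsilon> p] by (metis dist_minus minus_zero)
      then have "{p \<in> uminus ` P. dist (place 0 \<epsilon> p) (- z) < 1} = uminus ` {p\<in>P. dist (place 0 \<epsilon> p) z < 1}"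
        by (simp add: Compr_image_eq)
      then have "card {p \<in> uminus ` P. dist (place 0 \<epsilon> p) (- z) < 1} = card {p\<in>P. dist (place 0 \<epsilon> p) z < 1}"
        by (simp add: card_image)
      moreover have "(- z) $ 1 \<le> - 1 / 2" using 2 by simp
      ultimately have "avoiding_disk (uminus ` ?S) (- z) \<or> m \<le> card {p\<in>P. dist (place 0 \<epsilon> p) z < 1}"
        using right[rule_format, of "- z"] by (simp only:)
      then show ?thesis by (simp only: avoiding_disk_uminus)
    next
      case 3
      define \<sigma> :: real where "\<sigma> = (if 0 \<le> z $ 2 then 1 else - 1)"
      define c :: "real ^ 2" where "c = vector [0, z $ 2 + \<sigma> / 2]"
      have c: "c $ 1 = 0" "c $ 2 = z $ 2 + \<sigma> / 2" by (simp_all add: c_def)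
      have high: "1 / 2 \<le> \<bar>c $ 2\<bar>" by (auto simp: c \<sigma>_def)
      have "avoiding_disk ?S z"
      proof (rule avoiding_diskI[of c])
        have "(z $ 1)\<^sup>2 \<le> (1 / 2)\<^sup>2" using 3 by (intro abs_le_square_iff[THEN iffD1]) simp
        then show "dist c z < 1"
          by (auto simp: dist_less_1_iff c \<sigma>_def power2_eq_square)
        fix s assume "s \<in> ?S"
        then obtain u n where u: "u \<in> R \<union> B" "s = place n \<epsilon> u" "n = 1 \<or> n = - 1" by blast
        have sm: "\<bar>\<epsilon>\<^sup>2 * fst u\<bar> < 1 / 20" "\<bar>\<epsilon> * snd u\<bar> < 1 / 20" using small u(1) by blast+
        have "(19 / 20)\<^sup>2 \<le> (c $ 1 - s $ 1)\<^sup>2"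
          using sm(1) u(3) by (intro abs_le_square_iff[THEN iffD1]) (auto simp: u(2) c)
        moreover have "\<bar>9 / 20\<bar> \<le> \<bar>c $ 2 - s $ 2\<bar>"
          using sm(2) high unfolding u(2) place_nth by linarith
        then have "(9 / 20)\<^sup>2 \<le> (c $ 2 - s $ 2)\<^sup>2"
          by (rule abs_le_square_iff[THEN iffD1])
        ultimately show "1 < dist c s"
          unfolding dist_greater_1_iff by (simp add: power2_eq_square)
      qed
      then show ?thesis ..
    qed
  qed
qed

lemma inj_place: "0 < \<epsilon> \<Longrightarrow> inj (place n \<epsilon>)"
  by (auto simp: inj_def vec_eq_iff forall_2 prod_eq_iff)

text \<open>
  Both requirements on the centre are open, so one avoiding disk comes with infinitely many.
\<close>
lemma infinite_avoiding_disks: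
  assumes "finite S" "avoiding_disk S z"
  shows "infinite {D. (\<exists>c. D = ball c 1 \<and> (\<forall>s\<in>S. 1 < dist c s)) \<and> z \<in> D}"
proof -
  define U where "U = {c. dist c z < 1 \<and> (\<forall>s\<in>S. 1 < dist c s)}"
  have "U = ball z 1 \<inter> (\<Inter>s\<in>S. {c. 1 < dist c s})"
    by (auto simp: U_def dist_commute)
  moreover have "open {c. 1 < dist c s}" for s :: "real ^ 2"
    by (intro open_Collect_less continuous_intros)
  ultimately have "open U" using assms(1) by auto
  moreover have "U \<noteq> {}" using assms(2) by (auto simp: U_def avoiding_disk_def)
  ultimately have "infinite U" using finite_imp_not_open by blast
  moreover have "inj_on (\<lambda>c. ball c (1::real)) U"
    by (auto simp: inj_on_def ball_eq_ball_iff)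
  ultimately have "infinite ((\<lambda>c. ball c 1) ` U)" by (simp add: finite_image_iff)
  then show ?thesis
    by (rule infinite_super[rotated]) (auto simp: U_def)
qed

theorem theorem2:
  fixes m :: nat
  assumes "m > 0"
  shows "\<exists>\<C> :: (real ^ 2) set set.
           (\<forall>D\<in>\<C>. open_unit_disk D) \<and>
           fold_covering m \<C> UNIV \<and>
           \<not> splits_into_2_coverings \<C> UNIV"
proof -
  obtain P R B where un: "unsplittable m m P R B"
    and ex: "exposed R B" "exposed (uminus ` B) (uminus ` R)"
    using ex_unsplittable_exposed by blast
  have fin: "finite P" "finite R" "finite B" using un by (simp_all add: unsplittable_def)
  have "\<forall>\<^sub>F \<epsilon> in at_right 0. (0::real) < \<epsilon>"
    by (simp add: eventually_at_right_less)
  moreover have "\<forall>\<^sub>F \<epsilon> in at_right 0. \<forall>s\<in>R. \<forall>p\<in>P. bent \<epsilon> s p < 0 \<longleftrightarrow> gap s p < 0"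
    using un by (intro eventually_ball_finite fin ballI eventually_bent_iff_gap) (simp add: unsplittable_def)
  moreover have "\<forall>\<^sub>F \<epsilon> in at_right 0. \<forall>t\<in>B. \<forall>p\<in>P. bent \<epsilon> p t < 0 \<longleftrightarrow> gap p t < 0"
    using un by (intro eventually_ball_finite fin ballI eventually_bent_iff_gap) (simp add: unsplittable_def)
  moreover note eventually_covered[OF un ex]
  ultimately have "\<forall>\<^sub>F \<epsilon> in at_right 0. 0 < \<epsilon> \<and>
      (\<forall>s\<in>R. \<forall>p\<in>P. bent \<epsilon> s p < 0 \<longleftrightarrow> gap s p < 0) \<and> (\<forall>t\<in>B. \<forall>p\<in>P. bent \<epsilon> p t < 0 \<longleftrightarrow> gap p t < 0) \<and>
      (\<forall>z. avoiding_disk (place (- 1) \<epsilon> ` R \<union> place 1 \<epsilon> ` B) z \<or>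
        m \<le> card {p\<in>P. dist (place 0 \<epsilon> p) z < 1})"
    by (intro eventually_conj)
  then obtain \<epsilon> where \<epsilon>: "0 < \<epsilon>"
    and R: "\<forall>s\<in>R. \<forall>p\<in>P. bent \<epsilon> s p < 0 \<longleftrightarrow> gap s p < 0"
    and B: "\<forall>t\<in>B. \<forall>p\<in>P. bent \<epsilon> p t < 0 \<longleftrightarrow> gap p t < 0"
    and cov: "\<And>z. avoiding_disk (place (- 1) \<epsilon> ` R \<union> place 1 \<epsilon> ` B) z \<or>
        m \<le> card {p\<in>P. dist (place 0 \<epsilon> p) z < 1}"
    using eventually_happens'[OF trivial_limit_at_right_real] by blast
  define S where "S = place (- 1) \<epsilon> ` R \<union> place 1 \<epsilon> ` B"
  define disk where "disk p = ball (place 0 \<epsilon> p) 1" for p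
  define \<F> where "\<F> = {D. \<exists>c. D = ball c 1 \<and> (\<forall>s\<in>S. 1 < dist c s)}"
  define \<C> where "\<C> = disk ` P \<union> \<F>"
  have "\<forall>D\<in>\<C>. open_unit_disk D"
    by (auto simp: \<C>_def \<F>_def disk_def open_unit_disk_def)
  moreover have "fold_covering m \<C> UNIV"
    unfolding fold_covering_def
  proof
    fix z
    show "infinite {C\<in>\<C>. z \<in> C} \<or> m \<le> card {C\<in>\<C>. z \<in> C}"
    proof (cases "avoiding_disk S z")
      case True
      then have "infinite {D. (\<exists>c. D = ball c 1 \<and> (\<forall>s\<in>S. 1 < dist c s)) \<and> z \<in> D}"
        using fin by (intro infinite_avoiding_disks) (auto simp: S_def)
      then have "infinite {C\<in>\<C>. z \<in> C}"
        by (rule infinite_super[rotated]) (auto simp: \<C>_def \<F>_def)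
      then show ?thesis ..
    next
      case False
      let ?Q = "{p\<in>P. dist (place 0 \<epsilon> p) z < 1}"
      have "m \<le> card ?Q" using cov[of z] False by (simp add: S_def)
      also have "inj_on disk ?Q"
        using inj_place[OF \<epsilon>, of 0] by (auto simp: inj_on_def inj_def disk_def ball_eq_ball_iff)
      then have "card ?Q = card (disk ` ?Q)" by (simp add: card_image)
      finally have many: "m \<le> card (disk ` ?Q)" .
      have sub: "disk ` ?Q \<subseteq> {C\<in>\<C>. z \<in> C}" by (auto simp: \<C>_def disk_def)
      have "m \<le> card {C\<in>\<C>. z \<in> C}" if "finite {C\<in>\<C>. z \<in> C}"
        using many card_mono[OF that sub] by linarith
      then show ?thesis by blast
    qed
  qed
  moreover have "\<not> splits_into_2_coverings \<C> UNIV"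
  proof
    assume "splits_into_2_coverings \<C> UNIV"
    then obtain \<A> \<B> where AB: "\<A> \<union> \<B> = \<C>" "\<A> \<inter> \<B> = {}" "covering \<A> UNIV" "covering \<B> UNIV"
      by (auto simp: splits_into_2_coverings_def)
    have hit: "\<exists>D\<in>\<X>. z \<in> D" if "covering \<X> UNIV" for \<X> and z :: "real ^ 2"
    proof -
      have "infinite {C\<in>\<X>. z \<in> C} \<or> 1 \<le> card {C\<in>\<X>. z \<in> C}"
        using that unfolding fold_covering_def by blast
      then have "{C\<in>\<X>. z \<in> C} \<noteq> {}" by (metis card.empty finite.emptyI not_one_le_zero)
      then show ?thesis by blast
    qed
    \<comment> \<open>the special centres in \<open>S\<close> are covered by the disks around \<open>P\<close> only\<close>
    have only: "\<exists>p\<in>P. D = disk p \<and> dist (place 0 \<epsilon> p) z < 1" if "D \<in> \<C>" "z \<in> S" "z \<in> D" for D z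
    proof -
      have "D \<notin> \<F>" using that(2,3) by (force simp: \<F>_def)
      then show ?thesis using that by (auto simp: \<C>_def disk_def)
    qed
    from unsplittable_colouring[OF un, of "\<lambda>p. disk p \<in> \<A>"] show False
    proof (elim disjE bexE)
      fix s assume s: "s \<in> R" "\<forall>p\<in>P. gap s p < 0 \<longrightarrow> disk p \<in> \<A>"
      obtain D where D: "D \<in> \<B>" "place (- 1) \<epsilon> s \<in> D" using hit[OF AB(4)] by blast
      with only[of D "place (- 1) \<epsilon> s"] s(1) AB(1) obtain p where
        p: "p \<in> P" "D = disk p" "dist (place 0 \<epsilon> p) (place (- 1) \<epsilon> s) < 1" by (auto simp: S_def)
      then have "bent \<epsilon> s p < 0" using \<epsilon> by (simp add: dist_commute[of "place 0 \<epsilon> p"] dist_place)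
      then have "D \<in> \<A>" using s p R by blast
      with D(1) AB(2) show False by blast
    next
      fix t assume t: "t \<in> B" "\<forall>p\<in>P. gap p t < 0 \<longrightarrow> disk p \<notin> \<A>"
      obtain D where D: "D \<in> \<A>" "place 1 \<epsilon> t \<in> D" using hit[OF AB(3)] by blast
      with only[of D "place 1 \<epsilon> t"] t(1) AB(1) obtain p where
        p: "p \<in> P" "D = disk p" "dist (place 0 \<epsilon> p) (place 1 \<epsilon> t) < 1" by (auto simp: S_def)
      then have "bent \<epsilon> p t < 0" using \<epsilon> by (simp add: dist_place)
      then have "D \<notin> \<A>" using t p B by blast
      with D(1) show False by blast
    qed
  qed
  ultimately show ?thesis by blast
qed

end
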